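(* Let $s\ge1$, $N\in\mathbb N$, and let $\alpha_1,\dots,\alpha_{s+1},\beta\in\mathbb R$ satisfy $\alpha_1-1>\beta>0$, $\alpha_i>1$ for $2\le i\le s+1$. Let $x_1,\dots,x_s$ be integer variables, $x_{s+1}=N$. For $j\in\{1,\dots,s\}$ define $$\widetilde{\mathcal L}_j^{\mathbf x}=\widetilde{\mathcal L}_j^{\mathbf x}(x_1,\dots,x_j;\alpha_1,\dots,\alpha_{j+1},\beta,x_{j+1})=\sum_{\nu\in\{-1,0,1\}^j}\widetilde C_\nu(x_1,\dots,x_{j+1})T_{+,x_1}^{\nu_1}\cdots T_{+,x_j}^{\nu_j}$$ $$+\Big(\tfrac{\alpha_{[2;j+1]}+\beta}2+(-1)^{x_{j+1}}(\alpha_1-\beta-1)\big(x_{j+1}+\tfrac{\alpha_{[1;j+1]}}2\big)\Big),$$ with $\widetilde C_\nu$ as in the context. Then the operators $\widetilde{\mathcal L}_1^{\mathbf x},\dots,\widetilde{\mathcal L}_s^{\mathbf x}$ mutually commute, and the renormalized multivariate Bannai--Ito polynomials are common eigenfunctions: for every $\mathbf n\in\mathbb N^s$ and $j\in\{1,\dots,s\}$, $$\widetilde{\mathcal L}_j^{\mathbf x}\,\widehat B_{\mathbf n}(\mathbf x;\boldsymbol\alpha,\beta,N)=\widetilde\mu_j\,\widehat B_{\mathbf n}(\mathbf x;\boldsymbol\alpha,\beta,N),\qquad\widetilde\mu_j=\frac{\alpha_{[2;j+1]}+\beta}2-(-1)^{N_j}\Big(N_j+\frac{\alpha_{[2;j+1]}+\beta}2\Big),$$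 where $N_j=n_1+\dots+n_j$.
   Context: Notation: $\alpha_{[i;j]}=\alpha_i+\dots+\alpha_j$ (zero if $i>j$); $(a)_m=\prod_{t=0}^{m-1}(a+t)$; $m=2m_e+m_p$, $m_p\in\{0,1\}$; $T_{+,x_i}f(x_1,\dots,x_s)=f(x_1,\dots,x_i+1,\dots,x_s)$. Identities are understood at integer points where the rational coefficients are defined. Coefficients: $\widetilde C_\nu=\prod_{\ell=0}^j\widetilde B_\ell^{(\nu_\ell,\nu_{\ell+1})}/\prod_{\ell=1}^j\tilde b_\ell^{\nu_\ell}$ with $\nu_0=\nu_{j+1}=0$, where $\widetilde B_0^{(0,0)}=\frac12(-\beta+(-1)^{x_1}(2x_1+\alpha_1)(\beta-\alpha_1+1))$, $\widetilde B_0^{(0,1)}=-\frac12((2x_1+\alpha_1+\beta+1)+(-1)^{x_1}(\beta-\alpha_1+1))$, $\widetilde B_0^{(0,-1)}=\frac12((2x_1+\alpha_1-\beta-1)+(-1)^{x_1}(\beta-\alpha_1+1))$, and for $1\le\ell\le j$, with $\epsilon=(-1)^{x_\ell+x_{\ell+1}}$: $\widetilde B_\ell^{(0,0)}=(1-\alpha_{\ell+1})-\epsilon(2x_\ell+\alpha_{[1;\ell]})(2x_{\ell+1}+\alpha_{[1;\ell+1]})$, $\widetilde B_\ell^{(0,1)}=-(2x_{\ell+1}+\alpha_{[1;\ell+1]}+\alpha_{\ell+1})+\epsilon(2x_\ell+\alpha_{[1;\ell]})$, $\widetilde B_\ell^{(1,0)}=-(2x_\ell+\alpha_{[1;\ell+1]})+\epsilon(2x_{\ell+1}+\alpha_{[1;\ell+1]})$,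 $\widetilde B_\ell^{(1,1)}=-(2x_\ell+2x_{\ell+1}+2\alpha_{[1;\ell+1]}+1)-\epsilon$, $\widetilde B_\ell^{(-1,0)}=(2x_\ell+\alpha_{[1;\ell]}-\alpha_{\ell+1})-\epsilon(2x_{\ell+1}+\alpha_{[1;\ell+1]})$, $\widetilde B_\ell^{(-1,1)}=(2x_\ell-2x_{\ell+1}-2\alpha_{\ell+1}-1)+\epsilon$, $\widetilde B_\ell^{(0,-1)}=(2x_{\ell+1}+\alpha_{[1;\ell]})-\epsilon(2x_\ell+\alpha_{[1;\ell]})$, $\widetilde B_\ell^{(1,-1)}=-(2x_\ell-2x_{\ell+1}+1)+\epsilon$, $\widetilde B_\ell^{(-1,-1)}=(2x_\ell+2x_{\ell+1}+2\alpha_{[1;\ell]}-1)-\epsilon$, $\tilde b_\ell^0=-(2x_\ell+\alpha_{[1;\ell]}+1)(2x_\ell+\alpha_{[1;\ell]}-1)$, $\tilde b_\ell^1=-2(2x_\ell+\alpha_{[1;\ell]}+1)$, $\tilde b_\ell^{-1}=2(2x_\ell+\alpha_{[1;\ell]}-1)$. Univariate Bannai--Ito polynomials $B_m(x;\rho_1,\rho_2,r_1,r_2)$: $B_{-1}=0$, $B_0=1$, $xB_m=B_{m+1}+(\rho_1-A_m-C_m)B_m+A_{m-1}C_mB_{m-1}$ with $A_m=\frac{(m+2\rho_1-2r_1+m_p(2\rho_2-2r_2)+1)(m+2\rho_1-2r_2+m_p(2r_2+2\rho_2)+1)}{4(m+\rho_1+\rho_2-r_1-r_2+1)}$, $C_m=-\frac{(m+m_p(2\rho_2-2r_2))(m-2r_1-2r_2+m_p(2r_2+2\rho_2))}{4(m+\rho_1+\rho_2-r_1-r_2)}$.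 Multivariate: with $N_k=n_1+\dots+n_k$, $x_{s+1}=N$, $B_{\mathbf n}(\mathbf x;\boldsymbol\alpha,\beta,N)=\prod_{k=1}^sB_{n_k}\big(\frac{(-1)^{N_{k-1}+x_k}}2(x_k+\frac{\alpha_{[1;k]}}2)-\frac14;\rho_1^{(k)},\rho_2^{(k)},r_1^{(k)},r_2^{(k)}\big)$, where $X_k=\frac{(-1)^{N_{k-1}+x_{k+1}}}2(x_{k+1}+\frac{\alpha_{[1;k+1]}}2)$, $\rho_1^{(k)}=\frac{N_{k-1}}2+\frac{\alpha_{[1;k]}-1}4$, $\rho_2^{(k)}=X_k+\frac{\alpha_{k+1}-1}4$, $r_1^{(k)}=X_k-\frac{\alpha_{k+1}-1}4$, $r_2^{(k)}=-\frac{N_{k-1}}2+\frac{\alpha_1-\alpha_{[2;k]}-1}4-\frac\beta2$. Renormalized: $\widehat B_{\mathbf n}=k_{\mathbf n}B_{\mathbf n}$, with $$k_{\mathbf n}=\frac{(-1)^{N_sN+\sum_{k=2}^sn_kN_{k-1}}\prod_{k=1}^s\eta_k\theta_k}{\prod_{\ell=0}^{N_s-1}\big(-(2\ell+2N+\alpha_1+2\alpha_{[2;s+1]}+\beta+1)+(-1)^{N+\ell}(\alpha_1-\beta-1)\big)},$$ $\eta_k=\prod_{\ell=0}^{(n_k)_e+(n_k)_p-1}\frac{2\ell+2N_{k-1}+\alpha_{[2;k]}+\beta+1}{2\ell+\alpha_{k+1}}$, $\theta_k=\frac{(-8)^{n_k}\left(N_{k-1}+\frac{\alpha_{[2;k+1]}+\beta+1}2\right)_{n_k}}{\prod_{0\le\ell<n_k,\,\ell\text{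 even}}(\ell+2N_{k-1}+\alpha_{[2;k]}+\beta+1)\prod_{0\le\ell<n_k,\,\ell\text{ odd}}(\ell+2N_{k-1}+\alpha_{[2;k+1]}+\beta)}$. *)

theory Defs
  imports Complex_Main
begin

text \<open>
  Points are functions \<^typ>\<open>nat \<Rightarrow> int\<close>, of which only the entries \<open>1, \<dots>, s+1\<close> matter.  The variables
  are the entries \<open>1, \<dots>, s\<close>; the entry \<open>s+1\<close> is held at the value \<open>N\<close>.  Likewise only
  \<open>\<alpha> 1, \<dots>, \<alpha> (s+1)\<close> and \<open>n 1, \<dots>, n s\<close> are used.
\<close>

type_synonym point = "nat \<Rightarrow> int"

definition asum :: "(nat \<Rightarrow> real) \<Rightarrow> nat \<Rightarrow> nat \<Rightarrow> real" where
  "asum \<alpha> i j = (\<Sum>k=i..j. \<alpha> k)"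

definition psum :: "(nat \<Rightarrow> nat) \<Rightarrow> nat \<Rightarrow> nat" where
  "psum n k = (\<Sum>i=1..k. n i)"

section \<open>The difference operators\<close>

definition B_zero :: "(nat \<Rightarrow> real) \<Rightarrow> real \<Rightarrow> int \<Rightarrow> point \<Rightarrow> real" where
  "B_zero \<alpha> \<beta> b x =
    (if b = 0 then
       1/2 * (- \<beta> + (-1) powi (x 1) * (2 * real_of_int (x 1) + \<alpha> 1) * (\<beta> - \<alpha> 1 + 1))
     else if b = 1 then
       - (1/2) * ((2 * real_of_int (x 1) + \<alpha> 1 + \<beta> + 1) + (-1) powi (x 1) * (\<beta> - \<alpha> 1 + 1))
     else
       1/2 * ((2 * real_of_int (x 1) + \<alpha> 1 - \<beta> - 1) + (-1) powi (x 1) * (\<beta> - \<alpha> 1 + 1)))"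

definition B_pos :: "(nat \<Rightarrow> real) \<Rightarrow> nat \<Rightarrow> int \<Rightarrow> int \<Rightarrow> point \<Rightarrow> real" where
  "B_pos \<alpha> l a b x =
    (let \<epsilon> = (-1) powi (x l + x (l+1)) in
     if a = 0 \<and> b = 0 then
       (1 - \<alpha> (l+1)) - \<epsilon> * (2 * real_of_int (x l) + asum \<alpha> 1 l) * (2 * real_of_int (x (l+1)) + asum \<alpha> 1 (l+1))
     else if a = 0 \<and> b = 1 then
       - (2 * real_of_int (x (l+1)) + asum \<alpha> 1 (l+1) + \<alpha> (l+1)) + \<epsilon> * (2 * real_of_int (x l) + asum \<alpha> 1 l)
     else if a = 1 \<and> b = 0 then
       - (2 * real_of_int (x l) + asum \<alpha> 1 (l+1)) + \<epsilon> * (2 * real_of_int (x (l+1)) + asum \<alpha> 1 (l+1))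
     else if a = 1 \<and> b = 1 then
       - (2 * real_of_int (x l) + 2 * real_of_int (x (l+1)) + 2 * asum \<alpha> 1 (l+1) + 1) - \<epsilon>
     else if a = -1 \<and> b = 0 then
       (2 * real_of_int (x l) + asum \<alpha> 1 l - \<alpha> (l+1)) - \<epsilon> * (2 * real_of_int (x (l+1)) + asum \<alpha> 1 (l+1))
     else if a = -1 \<and> b = 1 then
       (2 * real_of_int (x l) - 2 * real_of_int (x (l+1)) - 2 * \<alpha> (l+1) - 1) + \<epsilon>
     else if a = 0 \<and> b = -1 then
       (2 * real_of_int (x (l+1)) + asum \<alpha> 1 l) - \<epsilon> * (2 * real_of_int (x l) + asum \<alpha> 1 l)
     else if a = 1 \<and> b = -1 then
       - (2 * real_of_int (x l) - 2 * real_of_int (x (l+1)) + 1) + \<epsilon>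
     else
       (2 * real_of_int (x l) + 2 * real_of_int (x (l+1)) + 2 * asum \<alpha> 1 l - 1) - \<epsilon>)"

definition B_coeff :: "(nat \<Rightarrow> real) \<Rightarrow> real \<Rightarrow> nat \<Rightarrow> int \<Rightarrow> int \<Rightarrow> point \<Rightarrow> real" where
  "B_coeff \<alpha> \<beta> l a b x = (if l = 0 then B_zero \<alpha> \<beta> b x else B_pos \<alpha> l a b x)"

definition b_coeff :: "(nat \<Rightarrow> real) \<Rightarrow> nat \<Rightarrow> int \<Rightarrow> point \<Rightarrow> real" where
  "b_coeff \<alpha> l a x =
    (if a = 0 then - (2 * real_of_int (x l) + asum \<alpha> 1 l + 1) * (2 * real_of_int (x l) + asum \<alpha> 1 l - 1)
     else if a = 1 then - 2 * (2 * real_of_int (x l) + asum \<alpha> 1 l + 1)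
     else 2 * (2 * real_of_int (x l) + asum \<alpha> 1 l - 1))"

text \<open>
  The elements of \<open>{-1,0,1}\<^sup>j\<close>, padded with zeros, which builds in \<open>\<nu>\<^sub>0 = 0\<close> and that the entry
  of index \<open>j+1\<close> vanishes.
\<close>

definition shifts :: "nat \<Rightarrow> (nat \<Rightarrow> int) set" where
  "shifts j = {\<nu>. \<forall>i. (i \<in> {1..j} \<longrightarrow> \<nu> i \<in> {-1, 0, 1}) \<and> (i \<notin> {1..j} \<longrightarrow> \<nu> i = 0)}"

lemma finite_shifts: "finite (shifts j)"
  unfolding shifts_def by (rule finite_set_of_finite_funs) auto

definition shift :: "(nat \<Rightarrow> int) \<Rightarrow> point \<Rightarrow> point" where
  "shift \<nu> x = (\<lambda>i. x i + \<nu> i)"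

definition C_coeff :: "(nat \<Rightarrow> real) \<Rightarrow> real \<Rightarrow> nat \<Rightarrow> (nat \<Rightarrow> int) \<Rightarrow> point \<Rightarrow> real" where
  "C_coeff \<alpha> \<beta> j \<nu> x =
    (\<Prod>l=0..j. B_coeff \<alpha> \<beta> l (\<nu> l) (\<nu> (l+1)) x) / (\<Prod>l=1..j. b_coeff \<alpha> l (\<nu> l) x)"

definition L_op ::
  "(nat \<Rightarrow> real) \<Rightarrow> real \<Rightarrow> nat \<Rightarrow> (point \<Rightarrow> real) \<Rightarrow> (point \<Rightarrow> real)" where
  "L_op \<alpha> \<beta> j f x =
    (\<Sum>\<nu>\<in>shifts j. C_coeff \<alpha> \<beta> j \<nu> x * f (shift \<nu> x)) +
    ((asum \<alpha> 2 (j+1) + \<beta>) / 2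
      + (-1) powi (x (j+1)) * (\<alpha> 1 - \<beta> - 1) * (real_of_int (x (j+1)) + asum \<alpha> 1 (j+1) / 2)) * f x"

text \<open>
  Division by zero yields zero here, so the points at which the coefficients are defined have to be
  singled out explicitly: all denominators of the coefficients are nonzero.  For a product of two
  operators, the coefficients of the outer one are taken at \<open>x\<close> and those of the inner one at all
  the shifts of \<open>x\<close> that the outer one produces.
\<close>

definition coeffs_defined :: "(nat \<Rightarrow> real) \<Rightarrow> nat \<Rightarrow> point \<Rightarrow> bool" where
  "coeffs_defined \<alpha> j x \<longleftrightarrow> (\<forall>l\<in>{1..j}. \<forall>a\<in>{-1, 0, 1}. b_coeff \<alpha> l a x \<noteq> 0)"

definition product_defined :: "(nat \<Rightarrow> real) \<Rightarrow> nat \<Rightarrow> nat \<Rightarrow> point \<Rightarrow> bool" where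
  "product_defined \<alpha> i j x \<longleftrightarrow>
    coeffs_defined \<alpha> i x \<and> (\<forall>\<nu>\<in>shifts i. coeffs_defined \<alpha> j (shift \<nu> x))"

section \<open>Bannai--Ito polynomials\<close>

definition BI_A :: "real \<Rightarrow> real \<Rightarrow> real \<Rightarrow> real \<Rightarrow> nat \<Rightarrow> real" where
  "BI_A \<rho>1 \<rho>2 r1 r2 m =
    (let mp = real (m mod 2) in
     (real m + 2*\<rho>1 - 2*r1 + mp * (2*\<rho>2 - 2*r2) + 1) * (real m + 2*\<rho>1 - 2*r2 + mp * (2*r2 + 2*\<rho>2) + 1)
       / (4 * (real m + \<rho>1 + \<rho>2 - r1 - r2 + 1)))"

definition BI_C :: "real \<Rightarrow> real \<Rightarrow> real \<Rightarrow> real \<Rightarrow> nat \<Rightarrow> real" where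
  "BI_C \<rho>1 \<rho>2 r1 r2 m =
    (let mp = real (m mod 2) in
     - ((real m + mp * (2*\<rho>2 - 2*r2)) * (real m - 2*r1 - 2*r2 + mp * (2*r2 + 2*\<rho>2))
       / (4 * (real m + \<rho>1 + \<rho>2 - r1 - r2))))"

text \<open>The three-term recurrence, solved for the polynomial of highest degree.\<close>

fun BI :: "nat \<Rightarrow> real \<Rightarrow> real \<Rightarrow> real \<Rightarrow> real \<Rightarrow> real \<Rightarrow> real" where
  "BI 0 x \<rho>1 \<rho>2 r1 r2 = 1"
| "BI (Suc 0) x \<rho>1 \<rho>2 r1 r2 = x - (\<rho>1 - BI_A \<rho>1 \<rho>2 r1 r2 0 - BI_C \<rho>1 \<rho>2 r1 r2 0)"
| "BI (Suc (Suc m)) x \<rho>1 \<rho>2 r1 r2 =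
     (x - (\<rho>1 - BI_A \<rho>1 \<rho>2 r1 r2 (Suc m) - BI_C \<rho>1 \<rho>2 r1 r2 (Suc m))) * BI (Suc m) x \<rho>1 \<rho>2 r1 r2
     - BI_A \<rho>1 \<rho>2 r1 r2 m * BI_C \<rho>1 \<rho>2 r1 r2 (Suc m) * BI m x \<rho>1 \<rho>2 r1 r2"

definition mvBI_factor ::
  "(nat \<Rightarrow> nat) \<Rightarrow> point \<Rightarrow> (nat \<Rightarrow> real) \<Rightarrow> real \<Rightarrow> nat \<Rightarrow> real" where
  "mvBI_factor n x \<alpha> \<beta> k =
    (let N' = psum n (k-1);
         X = (-1) powi (int N' + x (k+1)) / 2 * (real_of_int (x (k+1)) + asum \<alpha> 1 (k+1) / 2)
     in BI (n k)
          ((-1) powi (int N' + x k) / 2 * (real_of_int (x k) + asum \<alpha> 1 k / 2) - 1/4)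
          (real N' / 2 + (asum \<alpha> 1 k - 1) / 4)
          (X + (\<alpha> (k+1) - 1) / 4)
          (X - (\<alpha> (k+1) - 1) / 4)
          (- (real N' / 2) + (\<alpha> 1 - asum \<alpha> 2 k - 1) / 4 - \<beta> / 2))"

definition mvBI ::
  "nat \<Rightarrow> (nat \<Rightarrow> nat) \<Rightarrow> point \<Rightarrow> (nat \<Rightarrow> real) \<Rightarrow> real \<Rightarrow> nat \<Rightarrow> real" where
  "mvBI s n x \<alpha> \<beta> N = (\<Prod>k=1..s. mvBI_factor n (x(s+1 := int N)) \<alpha> \<beta> k)"

text \<open>The range of the product in \<open>\<eta>\<close> has \<open>(n\<^sub>k)\<^sub>e + (n\<^sub>k)\<^sub>p\<close> elements.\<close>

definition eta :: "(nat \<Rightarrow> nat) \<Rightarrow> (nat \<Rightarrow> real) \<Rightarrow> real \<Rightarrow> nat \<Rightarrow> real" where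
  "eta n \<alpha> \<beta> k =
    (\<Prod>l<n k div 2 + n k mod 2.
       (2 * real l + 2 * real (psum n (k-1)) + asum \<alpha> 2 k + \<beta> + 1) / (2 * real l + \<alpha> (k+1)))"

definition theta :: "(nat \<Rightarrow> nat) \<Rightarrow> (nat \<Rightarrow> real) \<Rightarrow> real \<Rightarrow> nat \<Rightarrow> real" where
  "theta n \<alpha> \<beta> k =
    (-8) ^ n k * pochhammer (real (psum n (k-1)) + (asum \<alpha> 2 (k+1) + \<beta> + 1) / 2) (n k) /
    ((\<Prod>l | l < n k \<and> even l. real l + 2 * real (psum n (k-1)) + asum \<alpha> 2 k + \<beta> + 1) *
     (\<Prod>l | l < n k \<and> odd l. real l + 2 * real (psum n (k-1)) + asum \<alpha> 2 (k+1) + \<beta>))"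

definition norm_const ::
  "nat \<Rightarrow> (nat \<Rightarrow> nat) \<Rightarrow> (nat \<Rightarrow> real) \<Rightarrow> real \<Rightarrow> nat \<Rightarrow> real" where
  "norm_const s n \<alpha> \<beta> N =
    (-1) ^ (psum n s * N + (\<Sum>k=2..s. n k * psum n (k-1)))
      * (\<Prod>k=1..s. eta n \<alpha> \<beta> k * theta n \<alpha> \<beta> k) /
    (\<Prod>l<psum n s.
       - (2 * real l + 2 * real N + \<alpha> 1 + 2 * asum \<alpha> 2 (s+1) + \<beta> + 1) + (-1) ^ (N + l) * (\<alpha> 1 - \<beta> - 1))"

definition mvBI_hat ::
  "nat \<Rightarrow> (nat \<Rightarrow> nat) \<Rightarrow> point \<Rightarrow> (nat \<Rightarrow> real) \<Rightarrow> real \<Rightarrow> nat \<Rightarrow> real" where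
  "mvBI_hat s n x \<alpha> \<beta> N = norm_const s n \<alpha> \<beta> N * mvBI s n x \<alpha> \<beta> N"

definition mu :: "(nat \<Rightarrow> real) \<Rightarrow> real \<Rightarrow> (nat \<Rightarrow> nat) \<Rightarrow> nat \<Rightarrow> real" where
  "mu \<alpha> \<beta> n j =
    (asum \<alpha> 2 (j+1) + \<beta>) / 2 - (-1) ^ psum n j * (real (psum n j) + (asum \<alpha> 2 (j+1) + \<beta>) / 2)"

end

theory Submission
  imports Defs
begin

text \<open>
  In the coordinates \<open>Y\<^sub>k = (-1)\<^bsup>x\<^sub>k\<^esup> (2 x\<^sub>k + \<alpha>\<^sub>1 + \<dots> + \<alpha>\<^sub>k)\<close> the two unit shifts of \<open>x\<^sub>k\<close> become the
  reflections \<open>Y \<mapsto> -Y - 2\<close> and \<open>Y \<mapsto> -Y + 2\<close>, and all signs disappear from the coefficients.  Leaving the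
  last index of the path \<open>\<nu>\<close> open turns the operator of level \<open>j\<close> into a triple \<open>W\<^sub>j\<^sup>A\<close> (\<open>path_op\<close>),
  \<open>A \<in> {-1,0,1}\<close>, and the triple of level \<open>j + 1\<close> is obtained from that of level \<open>j\<close> by a \<open>3 \<times> 3\<close> transfer matrix.

  The level \<open>j\<close> operator is, up to a constant, \<open>\<Lambda>\<^sub>j = W\<^sub>j\<^sup>0 - g Y\<^sub>j\<^sub>+\<^sub>1 / 2\<close> (\<open>path_casimir\<close>), where \<open>g = \<beta> - \<alpha>\<^sub>1 + 1\<close>.
  By induction on \<open>j\<close>, it commutes with \<open>W\<^sub>j\<^sup>\<plusminus>\<^sup>1\<close>, and the square of \<open>W\<^sub>j\<^sup>A\<close> is a quadratic
  polynomial in \<open>\<Lambda>\<^sub>j\<close> and \<open>Y\<^sub>j\<^sub>+\<^sub>1\<close>; hence \<open>\<Lambda>\<^sub>i\<close> commutes with \<open>W\<^sub>k\<^sup>A\<close> for all \<open>k \<ge> i\<close>.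

  The product of the first \<open>j\<close> univariate factors is an eigenfunction of all three \<open>W\<^sub>j\<^sup>A\<close>, the eigenvalue
  being the level \<open>0\<close> coefficient with \<open>\<beta>\<close> shifted.  The induction step is the univariate case, and this is
  proved by induction on the degree: for \<open>A = 0\<close> from a quadratic relation between the operator and multiplication
  by \<open>Y\<close>, for \<open>A = \<plusminus>1\<close> from a linear one, combined with the fact that
  \<open>B\<^sub>n + s\<^sub>n B\<^sub>n\<^sub>-\<^sub>1\<close> is invariant under \<open>Z \<mapsto> -Z - 2\<close>, where \<open>Z\<close> is the next coordinate.
  The normalizing constant plays no role, because it does not depend on the variables.
\<close>

section \<open>Univariate polynomials in reflection coordinates\<close>

text \<open>Four times the Bannai-Ito coefficient under rho1 = (b - g)/4, rho2 = (Z + a - 1)/4, r1 =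
  (Z - a + 1)/4, r2 = -(b + g)/4, h = b + a - 1. With argument (Y - 1)/4, the monic
  \<open>bi_poly\<close> is then 4^n times the Bannai-Ito polynomial.\<close>

definition bi_A :: "real \<Rightarrow> real \<Rightarrow> real \<Rightarrow> real \<Rightarrow> nat \<Rightarrow> real" where
  "bi_A b g h Z n = (if even n then (real n + 1 + b) * (2 * real n + 2 + h - g - Z)
     else (real n + 1 + h) * (2 * real n + 2 + h - g + Z)) / (2 * real n + 2 + h)"

definition bi_C :: "real \<Rightarrow> real \<Rightarrow> real \<Rightarrow> real \<Rightarrow> nat \<Rightarrow> real" where
  "bi_C b g h Z n = - (if even n then real n * (2 * real n + h + g - Z)
     else (real n + h - b) * (2 * real n + h + g + Z)) / (2 * real n + h)"

definition bi_b :: "real \<Rightarrow> real \<Rightarrow> real \<Rightarrow> real \<Rightarrow> nat \<Rightarrow> real" where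
  "bi_b b g h Z n = b - g + 1 - bi_A b g h Z n - bi_C b g h Z n"

definition bi_u :: "real \<Rightarrow> real \<Rightarrow> real \<Rightarrow> real \<Rightarrow> nat \<Rightarrow> real" where
  "bi_u b g h Z n = bi_A b g h Z (n - 1) * bi_C b g h Z n"

fun bi_poly :: "real \<Rightarrow> real \<Rightarrow> real \<Rightarrow> nat \<Rightarrow> real \<Rightarrow> real \<Rightarrow> real" where
  "bi_poly b g h 0 Y Z = 1"
| "bi_poly b g h (Suc 0) Y Z = Y - bi_b b g h Z 0"
| "bi_poly b g h (Suc (Suc n)) Y Z =
     (Y - bi_b b g h Z (Suc n)) * bi_poly b g h (Suc n) Y Z
     - bi_u b g h Z (Suc n) * bi_poly b g h n Y Z"

text \<open>The vanishing of C at degree 0 makes the truncated index \<open>n - 1\<close> harmless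
  at \<open>n = 0\<close>.\<close>

lemma bi_u_0 [simp]: "bi_u b g h Z 0 = 0"
  by (simp add: bi_u_def bi_C_def)

lemma bi_poly_rec:
  "Y * bi_poly b g h n Y Z = bi_poly b g h (Suc n) Y Z + bi_b b g h Z n * bi_poly b g h n Y Z
     + bi_u b g h Z n * bi_poly b g h (n - 1) Y Z"
  by (cases n) (simp_all add: algebra_simps)

text \<open>Chosen so that \<open>bi_q\<close> becomes invariant under Z \<mapsto> -Z - 2, see
  \<open>bi_q_sym\<close>.\<close>

definition bi_s :: "real \<Rightarrow> real \<Rightarrow> real \<Rightarrow> real \<Rightarrow> nat \<Rightarrow> real" where
  "bi_s b g h Z n = (if even n then real n * (2 * real n + h - g + Z)
     else (real n + b) * (2 * real n + h + g + Z)) / (2 * real n + h)"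

definition bi_q :: "real \<Rightarrow> real \<Rightarrow> real \<Rightarrow> nat \<Rightarrow> real \<Rightarrow> real \<Rightarrow> real" where
  "bi_q b g h n Y Z = bi_poly b g h n Y Z + bi_s b g h Z n * bi_poly b g h (n - 1) Y Z"

text \<open>The coefficients of the three-term recurrence of \<open>bi_q\<close>; unlike those of \<open>bi_poly\<close>, they are
  invariant under \<open>Z \<mapsto> -Z - 2\<close>.\<close>

definition bi_bq where
  "bi_bq b g h Z n = bi_b b g h Z n + bi_s b g h Z n - bi_s b g h Z (Suc n)"

definition bi_uq where
  "bi_uq b g h Z n = bi_u b g h Z (Suc n) - (bi_bq b g h Z (Suc n)
      - bi_b b g h Z n) * bi_s b g h Z (Suc n)"

lemma bi_bq_sym:
  assumes "h > 0" shows "bi_bq b g h (- Z - 2) n = bi_bq b g h Z n"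
proof -
  define r where "r = real n"
  \<comment> \<open>The denominators are among \<open>d\<close>, \<open>d + 2\<close>,
    \<open>d + 4\<close>, nonzero as \<open>h > 0\<close>. Eliminating \<open>h\<close> leaves one
    polynomial identity for each parity. Later coefficient identities follow the same
    pattern.\<close>
  define d where "d = 2 * r + h"
  have h: "h = d - 2 * r" and d: "d > 0" using assms by (auto simp: d_def r_def)
  have nz: "d \<noteq> 0" "d + 2 \<noteq> 0" "2 + d \<noteq> 0" "d + 4 \<noteq> 0" "4 + d \<noteq> 0" using d by auto
  show ?thesis
    unfolding bi_bq_def bi_b_def bi_A_def bi_C_def bi_s_def
    by (cases "even n"; simp add: r_def[symmetric] h; simp add: divide_simps nz; (thin_tac
        "_")?; algebra)
qed

text \<open>In this factored form Z \<mapsto> -Z - 2 just swaps the two factors that contain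
  Z.\<close>

lemma bi_uq_explicit:
  assumes "h > 0"
  shows "bi_uq b g h Z n = - (if odd n then (real n + 1) * (real n + h - b) * (2 * real n + 2 + h
      - g + Z) * (2 * real n + h - g - Z)
      else (real n + 1 + b) * (real n + h) * (2 * real n + 2 + h + g + Z) * (2 * real n + h + g
          - Z)) / ((2 * real n + 2 + h) * (2 * real n + h))"
proof -
  define r where "r = real n"
  define d where "d = 2 * r + h"
  have h: "h = d - 2 * r" and d: "d > 0" using assms by (auto simp: d_def r_def)
  have nz: "d \<noteq> 0" "d + 2 \<noteq> 0" "2 + d \<noteq> 0" "d + 4 \<noteq> 0" "4 + d \<noteq> 0" using d by auto
  show ?thesis
    unfolding bi_uq_def bi_bq_def bi_b_def bi_u_def bi_A_def bi_C_def bi_s_def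
    by (cases "even n"; simp add: r_def[symmetric] h; simp add: divide_simps nz; (thin_tac
        "_")?; algebra)
qed

lemma bi_uq_sym:
  assumes "h > 0" shows "bi_uq b g h (- Z - 2) n = bi_uq b g h Z n"
  using assms unfolding bi_uq_explicit[OF assms] by (simp add: algebra_simps)

text \<open>The compatibility condition that cancels the degree \<open>n - 1\<close> remainder in
  \<open>bi_q_rec\<close>, so that the recurrence of \<open>bi_q\<close> closes.\<close>

lemma bi_uq_s:
  assumes "h > 0"
  shows "bi_uq b g h Z n * bi_s b g h Z n = bi_s b g h Z (Suc n) * bi_u b g h Z n"
proof (cases n)
  case 0 then show ?thesis by (simp add: bi_s_def)
next
  case (Suc m)
  define r where "r = real m"
  define d where "d = 2 * r + h"
  have h: "h = d - 2 * r" and d: "d > 0" using assms by (auto simp: d_def r_def)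
  have nz: "d \<noteq> 0" "d + 2 \<noteq> 0" "2 + d \<noteq> 0" "d + 4 \<noteq> 0" "4 + d \<noteq> 0" using d by auto
  show ?thesis
    unfolding bi_uq_explicit[OF assms] bi_u_def bi_A_def bi_C_def bi_s_def Suc
    by (cases "even m"; simp add: r_def[symmetric] h; simp add: divide_simps nz; (thin_tac
        "_")?; algebra)
qed

lemma bi_q_rec:
  assumes "h > 0"
  shows "bi_q b g h (Suc (Suc n)) Y Z = (Y - bi_bq b g h Z (Suc n)) * bi_q b g h (Suc n) Y Z
      - bi_uq b g h Z n * bi_q b g h n Y Z"
  using bi_uq_s[OF assms, of b g Z n] bi_poly_rec[of Y b g h n Z] bi_poly_rec[of Y b g h "Suc n" Z]
  unfolding bi_q_def bi_uq_def bi_bq_def  diff_Suc_1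
  by algebra

text \<open>The recurrence coefficients and the two initial members are invariant.\<close>

lemma bi_q_sym:
  assumes "h > 0"
  shows "bi_q b g h n Y (- Z - 2) = bi_q b g h n Y Z"
proof (induction n rule: induct_nat_012)
  case 0 then show ?case by (simp add: bi_q_def bi_s_def)
next
  case 1
  have "bi_bq b g h (- Z - 2) 0 = bi_bq b g h Z 0" by (rule bi_bq_sym[OF assms])
  then show ?case by (simp add: bi_q_def bi_bq_def bi_s_def[of _ _ _ _ 0])
next
  case (ge2 n) then show ?case
      by (simp add: bi_q_rec[OF assms] bi_bq_sym[OF assms] bi_uq_sym[OF assms])
qed

section \<open>Reflection operators in one variable and their eigenfunctions\<close>

definition refl_coord :: "int \<Rightarrow> real \<Rightarrow> real" where
  "refl_coord A Y = (if A = 0 then Y else - Y - 2 * of_int A)"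

text \<open>
  With the sign absorbed into \<open>Y\<close> and \<open>Z\<close>, \<open>edge_coeff\<close> is the paper's \<open>B\<^sub>0\<^bsup>(0,A)\<^esup>\<close> with
  \<open>g = \<beta> - \<alpha>\<^sub>1 + 1\<close> and \<open>b = \<beta>\<close>, and \<open>link_coeff\<close> is \<open>B\<^sub>l\<^bsup>(A,B)\<^esup> / b\<^sub>l\<^bsup>A\<^esup>\<close> with \<open>a = \<alpha>\<^sub>l\<^sub>+\<^sub>1\<close>.
  The label \<open>A = \<plusminus>1\<close> names the reflection \<open>Y \<mapsto> -Y \<mp> 2\<close>; it is the shift by \<open>A\<close> only
  where the absorbed sign is positive, and the shift by \<open>-A\<close> elsewhere.
\<close>

definition edge_coeff :: "real \<Rightarrow> real \<Rightarrow> int \<Rightarrow> real \<Rightarrow> real" where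
  "edge_coeff b g A Y = (if A = 0 then (g * Y - b) / 2
     else - of_int A * (Y + of_int A * (b + 1) + g) / 2)"

definition link_coeff :: "real \<Rightarrow> int \<Rightarrow> int \<Rightarrow> real \<Rightarrow> real \<Rightarrow> real" where
  "link_coeff a A B Y Z =
    (if A = 0 \<and> B = 0 then 1 - a - Y * Z
     else if A = 0 then of_int B * (Y - Z - of_int B * a)
     else if B = 0 then of_int A * (Z - Y - of_int A * a)
     else - of_int A * (Y + of_int (A * B) * Z + of_int A * a + of_int (A + B))) /
    (if A = 0 then - (Y + 1) * (Y - 1) else - 2 * (of_int A * Y + 1))"

text \<open>One transfer step acting on the single variable Y: the level 0 weights enter, B is the
  open outgoing label, and Z is a parameter.\<close>

definition bi_op :: "real \<Rightarrow> real \<Rightarrow> real \<Rightarrow> int \<Rightarrow> real \<Rightarrow> (real \<Rightarrow> real) \<Rightarrow> real \<Rightarrow> real" where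
  "bi_op b g a B Z f Y
      = (\<Sum>A\<in>{-1, 0, 1}. edge_coeff b g A Y * link_coeff a A B Y Z * f (refl_coord A Y))"

lemma bi_op_add: "bi_op b g a B Z (\<lambda>y. f y + h y) Y = bi_op b g a B Z f Y + bi_op b g a B Z h Y"
  by (simp add: bi_op_def algebra_simps)

lemma bi_op_cmult: "bi_op b g a B Z (\<lambda>y. c * f y) Y = c * bi_op b g a B Z f Y"
  by (simp add: bi_op_def algebra_simps)

lemma bi_op_mult_var:
  "bi_op b g a B Z (\<lambda>y. y * bi_poly b' g' h n y Z') Y =
     bi_op b g a B Z (\<lambda>y. bi_poly b' g' h (Suc n) y Z') Y
     + bi_b b' g' h Z' n * bi_op b g a B Z (\<lambda>y. bi_poly b' g' h n y Z') Y
     + bi_u b' g' h Z' n * bi_op b g a B Z (\<lambda>y. bi_poly b' g' h (n - 1) y Z') Y"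
  unfolding bi_poly_rec bi_op_add bi_op_cmult ..

text \<open>Once the denominators are cleared, operator relations become polynomial identities in
  the three values of f at Y, -Y - 2 and 2 - Y.\<close>

lemma bi_op_0_cleared:
  assumes "Y \<noteq> 1" "Y \<noteq> -1"
  shows "4 * (Y\<^sup>2 - 1) * bi_op b g a 0 Z f Y =
    2 * (g * Y - b) * (a - 1 + Y * Z) * f Y
    + (Y - 1) * (Y + b + 1 + g) * (Z - Y - a) * f (- Y - 2)
    - (Y + 1) * (Y - b - 1 + g) * (Z - Y + a) * f (2 - Y)"
proof -
  have nz: "Y - 1 \<noteq> 0" "Y + 1 \<noteq> 0" "1 + Y \<noteq> 0" "Y \<noteq> 1" "- Y - 1 \<noteq> 0" "4 * Y - 4 \<noteq> 0" "- (4 * Y)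
      - 4 \<noteq> 0" "- (4 * Y) \<noteq> 4" using assms by auto
  show ?thesis unfolding bi_op_def edge_coeff_def link_coeff_def refl_coord_def
    by (simp add: nz, simp add: divide_simps nz, algebra)
qed

lemma bi_op_1_cleared:
  assumes "Y \<noteq> 1" "Y \<noteq> -1"
  shows "4 * (Y\<^sup>2 - 1) * bi_op b g a 1 Z f Y =
    - 2 * (g * Y - b) * (Y - Z - a) * f Y
    - (Y - 1) * (Y + b + 1 + g) * (Y + Z + a + 2) * f (- Y - 2)
    + (Y + 1) * (Y - b - 1 + g) * (Y - Z - a) * f (2 - Y)"
proof -
  have nz: "Y - 1 \<noteq> 0" "Y + 1 \<noteq> 0" "1 + Y \<noteq> 0" "Y \<noteq> 1" "- Y - 1 \<noteq> 0" "4 * Y - 4 \<noteq> 0" "- (4 * Y)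
      - 4 \<noteq> 0" "- (4 * Y) \<noteq> 4" using assms by auto
  show ?thesis unfolding bi_op_def edge_coeff_def link_coeff_def refl_coord_def
    by (simp add: nz, simp add: divide_simps nz, algebra)
qed

lemma sq_ne_one: "(Y::real) \<noteq> 1 \<Longrightarrow> Y \<noteq> -1 \<Longrightarrow> 4 * (Y\<^sup>2 - 1) \<noteq> 0"
  by (simp add: power2_eq_1_iff)

text \<open>The combined multiplier is \<open>(y + Y)\<^sup>2 - 4\<close>. It vanishes at both
  reflections of Y and equals \<open>4 * (Y\<^sup>2 - 1)\<close> at y = Y, so only the diagonal term
  survives and its denominator cancels.\<close>

lemma bi_op_0_quadratic:
  assumes "Y \<noteq> 1" "Y \<noteq> -1"
  shows "bi_op b g (h - b + 1) 0 Z (\<lambda>y. y * (y * f y)) Y + 2 * Y * bi_op b g (h - b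
      + 1) 0 Z (\<lambda>y. y * f y) Y
      + (Y\<^sup>2 - 4) * bi_op b g (h - b + 1) 0 Z f Y
    = (2 * g * Z * (Y\<^sup>2 - 1) + 2 * b * (b - h) + 2 * g * Z - (2 * b * Z + 2 * g * (b
        - h)) * Y) * f Y"
    (is "?L = ?R")
proof -
  note c = bi_op_0_cleared[OF assms, of b g "h - b + 1" Z]
  have "4 * (Y\<^sup>2 - 1) * ?L = 4 * (Y\<^sup>2 - 1) * ?R"
    using c[of f] c[of "\<lambda>y. y * f y"] c[of "\<lambda>y. y * (y * f y)"] by algebra
  then show ?thesis by (rule mult_left_cancel[OF sq_ne_one[OF assms], THEN iffD1])
qed

text \<open>The multiplier y + Y - 2 kills the terms at 2 - Y. Those at -Y - 2 agree because label 1
  at Z and label 0 at -Z - 2 have the same coefficient there, so only a diagonal term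
  remains.\<close>

lemma bi_op_1_linear:
  assumes "Y \<noteq> 1" "Y \<noteq> -1"
  shows "(Y - 2) * bi_op b g (h - b + 1) 1 Z f Y + bi_op b g (h - b + 1) 1 Z (\<lambda>y. y * f y) Y
    = (Y - 2) * bi_op b g (h - b + 1) 0 (- Z - 2) f Y + bi_op b g (h - b + 1) 0 (- Z
        - 2) (\<lambda>y. y * f y) Y
      + (Z + 1) * (g * Y - b) * f Y"
    (is "?L = ?R")
proof -
  note c = bi_op_1_cleared[OF assms, of b g "h - b + 1" Z]
  note c' = bi_op_0_cleared[OF assms, of b g "h - b + 1" "- Z - 2"]
  have "4 * (Y\<^sup>2 - 1) * ?L = 4 * (Y\<^sup>2 - 1) * ?R"
    using c[of f] c[of "\<lambda>y. y * f y"] c'[of f] c'[of "\<lambda>y. y * f y"] by algebra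
  then show ?thesis by (rule mult_left_cancel[OF sq_ne_one[OF assms], THEN iffD1])
qed

definition bi_mu :: "real \<Rightarrow> nat \<Rightarrow> real" where
  "bi_mu h n = - ((-1) ^ n * (2 * real n + h + 1)) / 2"

text \<open>Together with \<open>bi_u_diff\<close>, this is what comparing coefficients gives when
  \<open>bi_op_0_quadratic\<close> is applied to a polynomial of the sequence.\<close>

lemma bi_b_diff:
  assumes "h > 0"
  shows "(-1) ^ n * ((2 * real n + h + 4) * bi_b b g h Z (Suc n) - (2 * real n
      + h) * bi_b b g h Z n)
    = - 2 * b * Z - 2 * g * (b - h)"
proof -
  define r where "r = real n"
  define d where "d = 2 * r + h"
  have h: "h = d - 2 * r" and d: "d > 0" using assms by (auto simp: d_def r_def)
  have nz: "d \<noteq> 0" "d + 2 \<noteq> 0" "2 + d \<noteq> 0" "d + 4 \<noteq> 0" "4 + d \<noteq> 0" "4 + 2 * d \<noteq> 0" "4 + d * 2 \<noteq> 0"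
      using d by auto
  show ?thesis
    unfolding bi_b_def bi_A_def bi_C_def
    by (cases "even n"; simp add: r_def[symmetric] h; simp add: divide_simps nz; (thin_tac
        "_")?; algebra)
qed

lemma bi_u_diff:
  assumes "h > 0"
  shows "2 * (-1) ^ n * (bi_u b g h Z (Suc n) - bi_u b g h Z n)
      + 4 * bi_mu h n * ((bi_b b g h Z n)\<^sup>2 - 1)
    = 2 * b * (b - h) + 2 * g * Z - (2 * b * Z + 2 * g * (b - h)) * bi_b b g h Z n"
proof (cases n)
  case 0
  have nz: "h \<noteq> 0" "h + 2 \<noteq> 0" "2 + h \<noteq> 0" using assms by auto
  show ?thesis
    unfolding bi_b_def bi_u_def bi_A_def bi_C_def bi_mu_def 0
    by (simp add: divide_simps nz; (thin_tac "_")?; algebra)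
next
  case (Suc m)
  define r where "r = real m"
  define d where "d = 2 * r + h"
  have h: "h = d - 2 * r" and d: "d > 0" using assms by (auto simp: d_def r_def)
  have nz: "d \<noteq> 0" "d + 2 \<noteq> 0" "2 + d \<noteq> 0" "d + 4 \<noteq> 0" "4 + d \<noteq> 0" "4 + 2 * d \<noteq> 0" "4 + d * 2 \<noteq> 0"
      using d by auto
  show ?thesis
    unfolding bi_b_def bi_u_def bi_A_def bi_C_def bi_mu_def Suc
    by (cases "even m"; simp add: r_def[symmetric] h; simp add: divide_simps nz; (thin_tac
        "_")?; algebra)
qed

definition bi_gamma :: "real \<Rightarrow> real \<Rightarrow> real \<Rightarrow> nat \<Rightarrow> real" where
  "bi_gamma g h Z n = - ((-1) ^ n * (Z + 2 * real n + h + 2) + g) / 2"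

text \<open>
  Applied to \<open>bi_poly\<close> at \<open>-Z - 2\<close>, the right-hand side of \<open>bi_op_1_linear\<close> is a combination of three
  consecutive polynomials, and it regroups as \<open>((-1)\<^sup>n - g) bi_q\<^sub>n\<^sub>+\<^sub>1 + bi_kappa\<^sub>n bi_q\<^sub>n\<close>.  By \<open>bi_q_sym\<close> it can
  then be rewritten in terms of the polynomials at \<open>Z\<close>.
\<close>

definition bi_kappa :: "real \<Rightarrow> real \<Rightarrow> real \<Rightarrow> real \<Rightarrow> nat \<Rightarrow> real" where
  "bi_kappa b g h Z n =
    (if even n then (1 + g) * (real n + h) * (2 * real n + h + g + Z + 2)
     else - (1 - g) * (real n + h - b) * (2 * real n + h - g + Z + 2)) / (2 * real n + h)"

text \<open>The first two identities match the coefficients of the polynomials at Z, the last two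
  those of the polynomials at -Z - 2, in the induction step of \<open>bi_op_1_eigen\<close>.\<close>

lemma bi_op_1_coeffs:
  assumes "h > 0"
  shows "bi_gamma g h Z n * (bi_b b g h Z n - 2) + bi_b b g h (- Z - 2) n * bi_gamma g h Z n
      = ((-1) ^ n - g) * bi_s b g h Z (Suc n) + bi_kappa b g h Z n" (is ?J1)
   and "bi_gamma g h Z n * bi_u b g h Z n + bi_u b g h (- Z - 2) n * bi_gamma g h Z (n - 1)
       = bi_kappa b g h Z n * bi_s b g h Z n" (is ?J2)
   and "bi_kappa b g h Z n = (2 * bi_mu h n - g) * bi_b b g h (- Z - 2) n - 2 * bi_mu h n + (Z
       + 2) * g - (Z + 1) * b - ((-1)^n - g) * bi_s b g h (- Z - 2) (Suc n)" (is ?J3)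
   and "bi_kappa b g h Z n * bi_s b g h (- Z - 2) n = (- ((-1) ^ n) - g) * bi_u b g h (- Z - 2) n"
       (is ?J4)
proof -
  define r where "r = real n"
  define d where "d = 2 * r + h"
  have h: "h = d - 2 * r" and d: "d > 0" using assms by (auto simp: d_def r_def)
  have nz: "d \<noteq> 0" "d + 2 \<noteq> 0" "2 + d \<noteq> 0" "d + 4 \<noteq> 0" "4 + d \<noteq> 0" "4 + 2 * d \<noteq> 0" "4 + d * 2 \<noteq> 0"
      using d by auto
  show ?J1
    unfolding bi_b_def bi_A_def bi_C_def bi_s_def bi_gamma_def bi_kappa_def
    by (cases "even n"; simp add: r_def[symmetric] h; simp add: divide_simps nz; (thin_tac
        "_")?; algebra)
  show ?J3
    unfolding bi_b_def bi_A_def bi_C_def bi_s_def bi_gamma_def bi_kappa_def bi_mu_def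
    by (cases "even n"; simp add: r_def[symmetric] h; simp add: divide_simps nz; (thin_tac
        "_")?; algebra)
  have "?J2 \<and> ?J4"
  proof (cases n)
    case 0
    then show ?thesis by (simp add: bi_s_def)
  next
    case (Suc m)
    define r where "r = real m"
    define d where "d = 2 * r + h"
    have h: "h = d - 2 * r" and d: "d > 0" using assms by (auto simp: d_def r_def)
    have nz: "d \<noteq> 0" "d + 2 \<noteq> 0" "2 + d \<noteq> 0" "d + 4 \<noteq> 0" "4 + d \<noteq> 0" "4 + 2 * d \<noteq> 0" "4
        + d * 2 \<noteq> 0" using d by auto
    have ?J2
     unfolding bi_u_def bi_A_def bi_C_def bi_s_def bi_gamma_def bi_kappa_def Suc
     by (cases "even m"; simp add: r_def[symmetric] h; simp add: divide_simps nz; (thin_tac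
         "_")?; algebra)
    moreover have ?J4
     unfolding bi_u_def bi_A_def bi_C_def bi_s_def bi_gamma_def bi_kappa_def Suc
     by (cases "even m"; simp add: r_def[symmetric] h; simp add: divide_simps nz; (thin_tac
         "_")?; algebra)
    ultimately show ?thesis ..
  qed
  then show ?J2 ?J4 by auto
qed

text \<open>Apply the quadratic relation to degree n - 2 and expand multiplication by y through the
  recurrence: the operator on degree n is then expressed by its known values on lower degrees.
  Degrees 0 and 1 are computed directly.\<close>

lemma bi_op_0_eigen:
  assumes Y: "Y \<noteq> 1" "Y \<noteq> -1" and h: "h > 0"
  shows "bi_op b g (h - b + 1) 0 Z (\<lambda>y. bi_poly b g h n y Z) Y = (bi_mu h n
      + g * Z / 2) * bi_poly b g h n Y Z"
proof (induction n rule: less_induct)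
  case (less n)
  \<comment> \<open>Subtracting \<open>g * Z / 2\<close> removes the term
    \<open>2 * g * Z * (Y\<^sup>2 - 1)\<close> from the quadratic relation.\<close>
  define L where "L = (\<lambda>n. bi_op b g (h - b + 1) 0 Z (\<lambda>y. bi_poly b g h n y Z) Y
      - g * Z / 2 * bi_poly b g h n Y Z)"
  define p where "p = (\<lambda>n. bi_poly b g h n Y Z)"
  define B where "B = bi_b b g h Z"
  define U where "U = bi_u b g h Z"
  have IH: "L k = bi_mu h k * p k" if "k < n" for k
    using less[OF that] by (simp add: L_def p_def algebra_simps)
  have "L n = bi_mu h n * p n"
  proof (cases n)
    case 0
    have "4 * (Y\<^sup>2 - 1) * L 0 = 4 * (Y\<^sup>2 - 1) * (bi_mu h 0 * p 0)"
      using bi_op_0_cleared[OF Y, of b g "h - b + 1" Z "\<lambda>y. bi_poly b g h 0 y Z"]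
      unfolding L_def p_def bi_mu_def bi_poly.simps power_0 of_nat_0 by algebra
    then show ?thesis unfolding 0 by (rule mult_left_cancel[OF sq_ne_one[OF Y], THEN iffD1])
  next
    case (Suc m)
    show ?thesis
    proof (cases m)
      case 0
      have "B 0 = b - g + 1 - (1 + b) * (2 + h - g - Z) / (2 + h)"
        using h by (simp add: B_def bi_b_def bi_A_def bi_C_def)
      then have B0: "(2 + h) * B 0 = (2 + h) * (b - g + 1) - (1 + b) * (2 + h - g - Z)"
        using h by (simp add: field_simps)
      have "4 * (Y\<^sup>2 - 1) * L n = 4 * (Y\<^sup>2 - 1) * (bi_mu h n * p n)"
        using B0 bi_op_0_cleared[OF Y, of b g "h - b + 1" Z "\<lambda>y. bi_poly b g h n y Z"]
        unfolding L_def p_def bi_mu_def Suc 0 bi_poly.simps B_def[symmetric]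
          power_Suc power_0 of_nat_Suc of_nat_0
        by algebra
      then show ?thesis by (rule mult_left_cancel[OF sq_ne_one[OF Y], THEN iffD1])
    next
      case (Suc k)
      have prec: "Y * p i = p (Suc i) + B i * p i + U i * p (i - 1)" for i
        unfolding p_def B_def U_def by (rule bi_poly_rec)
      define LY where "LY = (\<lambda>i. L (Suc i) + B i * L i + U i * L (i - 1))"
      have LY: "bi_op b g (h - b + 1) 0 Z (\<lambda>y. y * bi_poly b g h i y Z) Y - g * Z / 2 * (Y * p i)
          = LY i" for i
        unfolding LY_def L_def bi_op_mult_var prec unfolding p_def B_def U_def
            by (simp add: algebra_simps)
      have expand: "(\<lambda>y. y * (y * bi_poly b g h k y Z)) =
        (\<lambda>y. (y * bi_poly b g h (Suc k) y Z + B k * (y * bi_poly b g h k y Z))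
            + U k * (y * bi_poly b g h (k - 1) y Z))"
        using arg_cong[OF bi_poly_rec[of _ b g h k Z], where f = "(*) _"]
        by (intro ext) (simp add: B_def U_def algebra_simps)
      have LYY: "bi_op b g (h - b + 1) 0 Z (\<lambda>y. y * (y * bi_poly b g h k y Z)) Y
          - g * Z / 2 * (Y * (Y * p k))
           = LY (Suc k) + B k * LY k + U k * LY (k - 1)"
        using arg_cong[OF prec[of k], of "(*) (g * Z / 2 * Y)"]
        unfolding expand bi_op_add bi_op_cmult LY[symmetric] by (simp add: algebra_simps)
      define \<tau> where "\<tau> = (-1 :: real) ^ k"
      define m0 where "m0 = bi_mu h k"
      have mu: "bi_mu h (Suc i) = (-1) ^ i - bi_mu h i" for i
        by (simp add: bi_mu_def field_simps)
      have mu1: "bi_mu h (Suc k) = \<tau> - m0" and mu2: "bi_mu h n = m0 - 2 * \<tau>"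
        using Suc \<open>n = Suc m\<close> by (simp_all add: mu m0_def \<tau>_def)
      have Lk: "L k = m0 * p k" and Lk1: "L (Suc k) = (\<tau> - m0) * p (Suc k)"
        using IH[of k] IH[of "Suc k"] Suc \<open>n = Suc m\<close> by (simp_all add: mu1 m0_def)
      \<comment> \<open>The factor \<open>U k\<close> is kept to cover k = 0, where it vanishes and
        \<open>k - 1\<close> is truncated.\<close>
      have Uk: "U k * L (k - 1) = U k * (- \<tau> - m0) * p (k - 1)"
        using IH[of "k - 1"] Suc \<open>n = Suc m\<close>
        by (cases k) (simp_all add: U_def m0_def \<tau>_def mu)
      have UUk: "U k * (U (k - 1) * L (k - 1 - 1)) = U k * (U (k - 1) * ((m0 + 2 * \<tau>) * p (k - 1
          - 1)))"
      proof (cases "k \<le> 1")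
        case True
        then have "k = 0 \<or> k = 1" by auto
        then show ?thesis by (auto simp: U_def)
      next
        case False
        then obtain l where "k = Suc (Suc l)" by (cases k) (auto simp: gr0_conv_Suc)
        then show ?thesis
          using IH[of l] Suc \<open>n = Suc m\<close> by (simp add: m0_def \<tau>_def mu)
      qed
      have ULY: "U k * LY (k - 1) = U k * (m0 * p k + B (k - 1) * (- \<tau> - m0) * p (k - 1) + U (k
          - 1) * (m0 + 2 * \<tau>) * p (k - 1 - 1))"
      proof -
        have "U k * LY (k - 1) = U k * L k + B (k - 1) * (U k * L (k - 1)) + U k * (U (k
            - 1) * L (k - 1 - 1))"
          by (cases k) (simp_all add: LY_def U_def algebra_simps)
        then show ?thesis unfolding Lk Uk UUk by (simp add: algebra_simps)
      qed
      have Up: "U k * (Y * p (k - 1)) = U k * (p k + B (k - 1) * p (k - 1) + U (k - 1) * p (k - 1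
          - 1))"
        by (cases k) (simp_all add: prec U_def)
      define e0 e1 where "e0 = 2 * b * (b - h) + 2 * g * Z" and "e1 = 2 * b * Z + 2 * g * (b - h)"
      have I1: "B (Suc k) * (3 * \<tau> - 2 * m0) + B k * (\<tau> + 2 * m0) = - e1"
        using bi_b_diff[OF h, of k b g Z] unfolding B_def \<tau>_def m0_def bi_mu_def e1_def
        by (simp add: field_simps)
      have I1': "U k * (B k * (2 * m0 - \<tau>) - B (k - 1) * (3 * \<tau> + 2 * m0)) = - U k * e1"
      proof (cases k)
        case (Suc l)
        have "B k * (2 * m0 - \<tau>) - B (k - 1) * (3 * \<tau> + 2 * m0) = - e1"
          using bi_b_diff[OF h, of l b g Z] Suc
          by (simp add: B_def \<tau>_def m0_def e1_def bi_mu_def field_simps)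
        then show ?thesis by simp
      qed (simp add: U_def)
      have I2: "2 * \<tau> * (U (Suc k) - U k) + 4 * m0 * ((B k)\<^sup>2 - 1) = e0 - e1 * B k"
        using bi_u_diff[OF h, of k b g Z] by (simp add: U_def B_def \<tau>_def m0_def e1_def e0_def)
      have quad: "LY (Suc k) + B k * LY k + U k * LY (k - 1) + 2 * Y * LY k + (Y\<^sup>2 - 4) * L k
         = (e0 - e1 * Y) * p k"
        using bi_op_0_quadratic[OF Y, of b g h Z "\<lambda>y. bi_poly b g h k y Z"]
        unfolding LYY[symmetric] unfolding LY[symmetric] L_def p_def e0_def e1_def
        by (simp add: field_simps power2_eq_square)
      have r0: "Y * p k = p (Suc k) + B k * p k + U k * p (k - 1)" by (rule prec)
      have r1: "Y * p (Suc k) = p n + B (Suc k) * p (Suc k) + U (Suc k) * p k"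
        using prec[of "Suc k"] Suc \<open>n = Suc m\<close> by simp
      have LYk: "LY k = (\<tau> - m0) * p (Suc k) + B k * (m0 * p k) + U k * (- \<tau> - m0) * p (k - 1)"
        unfolding LY_def Lk Lk1 Uk ..
      have LYk1: "LY (Suc k) = L n + B (Suc k) * ((\<tau> - m0) * p (Suc k)) + U (Suc k) * (m0 * p k)"
        using Suc \<open>n = Suc m\<close> by (simp add: LY_def Lk Lk1)
      \<comment> \<open>The first bracket is the quadratic relation with the known values of
        \<open>L\<close> inserted; every further line is a multiple of a recurrence or coefficient
        identity that vanishes.\<close>
      have "L n - (m0 - 2 * \<tau>) * p n =
          (L n + B (Suc k) * ((\<tau> - m0) * p (Suc k)) + U (Suc k) * (m0 * p k)
            + B k * ((\<tau> - m0) * p (Suc k) + B k * (m0 * p k) + U k * (- \<tau> - m0) * p (k - 1))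
            + U k * (m0 * p k + B (k - 1) * (- \<tau> - m0) * p (k - 1) + U (k - 1) * (m0
                + 2 * \<tau>) * p (k - 1 - 1))
            + 2 * Y * ((\<tau> - m0) * p (Suc k) + B k * (m0 * p k) + U k * (- \<tau> - m0) * p (k - 1))
            + (Y\<^sup>2 - 4) * (m0 * p k) - (e0 - e1 * Y) * p k)
          - (m0 * Y + 3 * m0 * B k + e1) * (Y * p k - (p (Suc k) + B k * p k + U k * p (k - 1)))
          - (2 * \<tau> - m0) * (Y * p (Suc k) - (p n + B (Suc k) * p (Suc k) + U (Suc k) * p k))
          + (2 * \<tau> + m0) * (U k * (Y * p (k - 1)) - U k * (p k + B (k - 1) * p (k - 1) + U (k
              - 1) * p (k - 1 - 1)))
          - p (Suc k) * (B (Suc k) * (3 * \<tau> - 2 * m0) + B k * (\<tau> + 2 * m0) - - e1)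
          - p (k - 1) * (U k * (B k * (2 * m0 - \<tau>) - B (k - 1) * (3 * \<tau> + 2 * m0)) - - U k * e1)
          - p k * (2 * \<tau> * (U (Suc k) - U k) + 4 * m0 * ((B k)\<^sup>2 - 1) - (e0 - e1 * B k))"
        by algebra
      also have "\<dots> = 0"
        unfolding quad[unfolded ULY LYk LYk1 Lk] r0 r1 Up I1 I1' I2 by simp
      finally show ?thesis unfolding mu2 by simp
    qed
  qed
  then show ?case by (simp add: L_def p_def algebra_simps)
qed

text \<open>Apply the linear relation to the polynomial at -Z - 2. Its right-hand side is known from
  \<open>bi_op_0_eigen\<close>; \<open>bi_q_sym\<close> transports it to Z, where it determines the
  value in the next degree.\<close>

lemma bi_op_1_eigen:
  assumes Y: "Y \<noteq> 1" "Y \<noteq> -1" and h: "h > 0"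
  shows "bi_op b g (h - b + 1) 1 Z (\<lambda>y. bi_poly b g h n y (- Z - 2)) Y
      = bi_gamma g h Z n * bi_poly b g h n Y Z"
proof (induction n rule: less_induct)
  case (less n)
  show ?case
  proof (cases n)
    case 0
    have "4 * (Y\<^sup>2 - 1) * bi_op b g (h - b + 1) 1 Z (\<lambda>y. bi_poly b g h n y (- Z - 2)) Y
       = 4 * (Y\<^sup>2 - 1) * (bi_gamma g h Z n * bi_poly b g h n Y Z)"
      using bi_op_1_cleared[OF Y, of b g "h - b + 1" Z "\<lambda>y. bi_poly b g h n y (- Z - 2)"]
      unfolding 0 bi_gamma_def bi_poly.simps power_0 of_nat_0 by algebra
    then show ?thesis by (rule mult_left_cancel[OF sq_ne_one[OF Y], THEN iffD1])
  next
    case (Suc m)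
    define p where "p = (\<lambda>n. bi_poly b g h n Y Z)"
    define p' where "p' = (\<lambda>n. bi_poly b g h n Y (- Z - 2))"
    define K where "K = (\<lambda>n. bi_op b g (h - b + 1) 1 Z (\<lambda>y. bi_poly b g h n y (- Z - 2)) Y)"
    note u = bi_op_1_linear[OF Y, of b g h Z "\<lambda>y. bi_poly b g h m y (- Z - 2)",
       unfolded bi_op_mult_var bi_op_0_eigen[OF Y h]]
    have folds: "bi_op b g (h - b + 1) 1 Z (\<lambda>y. bi_poly b g h i y (- Z - 2)) Y = K i"
      "bi_poly b g h i Y Z = p i" "bi_poly b g h i Y (- Z - 2) = p' i" for i
      by (simp_all add: K_def p_def p'_def)
    have IH: "K m = bi_gamma g h Z m * p m"
      using less[of m] Suc by (simp add: K_def p_def)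
    have IH2: "bi_u b g h (- Z - 2) m * K (m - 1) = bi_u b g h (- Z - 2) m * (bi_gamma g h Z (m
        - 1) * p (m - 1))"
      using less[of "m - 1"] Suc by (cases m) (simp_all add: K_def p_def)
    have mu2: "bi_u b g h (- Z - 2) m * bi_mu h (m - 1) = bi_u b g h (- Z - 2) m * (- ((-1) ^ m)
        - bi_mu h m)"
      by (cases m) (auto simp: bi_mu_def field_simps)
    have mu1: "bi_mu h (Suc m) = (-1) ^ m - bi_mu h m"
      by (simp add: bi_mu_def field_simps)
    have ga: "bi_gamma g h Z (Suc m) = (-1) ^ m - g - bi_gamma g h Z m"
      by (simp add: bi_gamma_def field_simps)
    have q: "p i + bi_s b g h Z i * p (i - 1) = p' i + bi_s b g h (- Z - 2) i * p' (i - 1)" for i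
      using bi_q_sym[OF h, of b g i Y Z] by (simp add: bi_q_def p_def p'_def)
    note q1 = q[of m] and q2 = q[of "Suc m", unfolded diff_Suc_1]
    have rp: "Y * p m = p (Suc m) + bi_b b g h Z m * p m + bi_u b g h Z m * p (m - 1)"
      unfolding p_def by (rule bi_poly_rec)
    have rp': "Y * p' m = p' (Suc m) + bi_b b g h (- Z - 2) m * p' m + bi_u b g h (- Z
        - 2) m * p' (m - 1)"
      unfolding p'_def by (rule bi_poly_rec)
    note J = bi_op_1_coeffs[OF h, where g = g and Z = Z and n = m and b = b]
    define \<gamma> where "\<gamma> = bi_gamma g h Z m"
    define \<gamma>' where "\<gamma>' = bi_gamma g h Z (m - 1)"
    define \<tau> where "\<tau> = (-1 :: real) ^ m"
    define \<mu> where "\<mu> = bi_mu h m"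
    define \<mu>' where "\<mu>' = bi_mu h (m - 1)"
    define c where "c = bi_kappa b g h Z m"
    define B where "B = bi_b b g h Z m"
    define B' where "B' = bi_b b g h (- Z - 2) m"
    define U where "U = bi_u b g h Z m"
    define U' where "U' = bi_u b g h (- Z - 2) m"
    define G where "G = g * (- Z - 2) / 2"
    define s0 t0 s1 t1 where "s0 = bi_s b g h Z m" and "t0 = bi_s b g h (- Z - 2) m"
      and "s1 = bi_s b g h Z (Suc m)" and "t1 = bi_s b g h (- Z - 2) (Suc m)"
    note defs = \<gamma>_def \<gamma>'_def \<tau>_def \<mu>_def \<mu>'_def c_def B_def B'_def U_def U'_def
      G_def s0_def t0_def s1_def t1_def
    have G: "2 * G + g * (Z + 2) = 0" by (simp add: G_def field_simps)
    note J' = J[folded defs]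
    \<comment> \<open>Again a certificate: the linear relation, plus multiples of the recurrences at
      Z and -Z - 2, the coefficient identities and the two invariances of
      \<open>bi_q\<close>.\<close>
    have "K (Suc m) - (\<tau> - g - \<gamma>) * p (Suc m) =
        ((Y - 2) * (\<gamma> * p m) + (K (Suc m) + B' * (\<gamma> * p m) + U' * (\<gamma>' * p (m - 1)))
          - ((Y - 2) * ((\<mu> + G) * p' m) + ((\<tau> - \<mu> + G) * p' (Suc m) + B' * ((\<mu> + G) * p' m)
              + U' * ((\<mu>' + G) * p' (m - 1))) + (Z + 1) * (g * Y - b) * p' m))
        - \<gamma> * (Y * p m - (p (Suc m) + B * p m + U * p (m - 1)))
        + (\<mu> + G + (Z + 1) * g) * (Y * p' m - (p' (Suc m) + B' * p' m + U' * p' (m - 1)))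
        - p m * (\<gamma> * (B - 2) + B' * \<gamma> - ((\<tau> - g) * s1 + c))
        - p (m - 1) * (\<gamma> * U + U' * \<gamma>' - c * s0)
        - p' m * (c - ((2 * \<mu> - g) * B' - 2 * \<mu> + (Z + 2) * g - (Z + 1) * b - (\<tau> - g) * t1))
        - p' (m - 1) * (c * t0 - (- \<tau> - g) * U')
        - c * (p m + s0 * p (m - 1) - (p' m + t0 * p' (m - 1)))
        - (\<tau> - g) * (p (Suc m) + s1 * p m - (p' (Suc m) + t1 * p' m))
        + p' (m - 1) * (U' * \<mu>' - U' * (- \<tau> - \<mu>))
        + (p' (Suc m) + B' * p' m - p' m + U' * p' (m - 1)) * (2 * G + g * (Z + 2))"
      by algebra
    also have "\<dots> = 0"
      unfolding u[unfolded folds mu1 IH IH2, folded defs] rp[folded defs] rp'[folded defs]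
        J'(1,2) q1[folded defs] q2[folded defs] mu2[folded defs] G
      unfolding J'(3)[symmetric] J'(4) by simp
    finally show ?thesis
      unfolding Suc folds ga \<tau>_def \<gamma>_def by simp
  qed
qed

section \<open>Simultaneous sign change of coordinates and labels\<close>

lemma link_coeff_neg: "link_coeff a (- A) (- B) (- Y) (- Z) = link_coeff a A B Y Z"
proof -
  have "- 2 * (of_int (- A) * (- Y) + 1) = - 2 * (of_int A * Y + (1 :: real))" by simp
  then show ?thesis by (auto simp: link_coeff_def algebra_simps)
qed

lemma edge_coeff_neg: "edge_coeff b (- g) (- A) (- Y) = edge_coeff b g A Y"
  by (simp add: edge_coeff_def algebra_simps)

lemma refl_coord_neg: "refl_coord (- A) (- Y) = - refl_coord A Y"
  by (simp add: refl_coord_def)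

lemma bi_op_neg: "bi_op b (- g) a (- B) (- Z) (\<lambda>y. f (- y)) (- Y) = bi_op b g a B Z f Y"
proof -
  have "bi_op b g a B Z f Y
      = (\<Sum>A\<in>uminus ` {-1, 0, 1}. edge_coeff b g A Y * link_coeff a A B Y Z * f (refl_coord A Y))"
    unfolding bi_op_def by (rule sum.cong) auto
  also have "\<dots> = bi_op b (- g) a (- B) (- Z) (\<lambda>y. f (- y)) (- Y)"
    unfolding bi_op_def
    by (subst sum.reindex) (auto simp: inj_on_def edge_coeff_neg[symmetric, of b g "- _"]
        link_coeff_neg[symmetric, of a
            "- _"] refl_coord_neg[symmetric] simp del: minus_equation_iff)
  finally show ?thesis ..
qed

lemma bi_b_neg:
  assumes "h > 0" shows "bi_b b (- g) h (- Z) n = - bi_b b g h Z n"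
proof -
  define r where "r = real n"
  define d where "d = 2 * r + h"
  have h: "h = d - 2 * r" and d: "d > 0" using assms by (auto simp: d_def r_def)
  have nz: "d \<noteq> 0" "d + 2 \<noteq> 0" "2 + d \<noteq> 0" "4 + 2 * d \<noteq> 0" "4 + d * 2 \<noteq> 0" using d by auto
  show ?thesis
    unfolding bi_b_def bi_A_def bi_C_def
    by (cases "even n"; simp add: r_def[symmetric] h; simp add: divide_simps nz; (thin_tac
        "_")?; algebra)
qed

lemma bi_u_neg: "bi_u b (- g) h (- Z) n = bi_u b g h Z n"
  by (cases n) (auto simp: bi_u_def bi_A_def bi_C_def algebra_simps)

lemma bi_poly_neg:
  assumes "h > 0"
  shows "bi_poly b (- g) h n (- Y) (- Z) = (-1) ^ n * bi_poly b g h n Y Z"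
  by (induction n rule: induct_nat_012) (simp_all add: bi_b_neg[OF assms] bi_u_neg algebra_simps)

text \<open>The eigenvalue is again an \<open>edge_coeff\<close>, with b replaced by 2n + h + 1;
  this lets the induction over levels repeat the same step. Label -1 follows from label 1 by the
  sign change.\<close>

lemma bi_op_eigen:
  assumes Y: "Y \<noteq> 1" "Y \<noteq> -1" and h: "h > 0" and B: "B \<in> {-1, 0, 1}"
  shows "bi_op b g (h - b + 1) B Z (\<lambda>y. bi_poly b g h n y (refl_coord B Z)) Y =
    (-1) ^ n * edge_coeff (2 * real n + h
        + 1) g ((-1) ^ n * B) ((-1) ^ n * Z) * bi_poly b g h n Y Z"
proof -
  have one: "bi_op b g (h - b + 1) 1 Z (\<lambda>y. bi_poly b g h n y (refl_coord 1 Z)) Y =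
    (-1) ^ n * edge_coeff (2 * real n + h + 1) g ((-1) ^ n) ((-1) ^ n * Z) * bi_poly b g h n Y Z"
    if Y: "Y \<noteq> 1" "Y \<noteq> -1" for g Y Z
    using bi_op_1_eigen[OF Y h, of b g Z n]
    by (cases "even n") (simp_all add: refl_coord_def edge_coeff_def bi_gamma_def field_simps)
  consider "B = 1" | "B = 0" | "B = -1" using B by auto
  then show ?thesis
  proof cases
    case 1 then show ?thesis using one[OF Y] by simp
  next
    case 2 then show ?thesis using bi_op_0_eigen[OF Y h, of b g Z n]
      by (cases "even n") (simp_all add: refl_coord_def edge_coeff_def bi_mu_def field_simps)
  next
    case 3
    have "bi_op b g (h - b + 1) (- 1) Z (\<lambda>y. bi_poly b g h n y (refl_coord (- 1) Z)) Y
      = bi_op b (- g) (h - b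
          + 1) 1 (- Z) (\<lambda>y. (-1) ^ n * bi_poly b (- g) h n y (refl_coord 1 (- Z))) (- Y)"
      unfolding bi_op_neg[of b g "h - b + 1" "- 1" Z _ Y, symmetric]
      using bi_poly_neg[OF h, of b "- g" n _ "refl_coord 1 (- Z)"] by (simp add: refl_coord_def)
    also have "\<dots> = (-1) ^ n * ((-1) ^ n * edge_coeff (2 * real n + h
        + 1) (- g) ((-1) ^ n) ((-1) ^ n * (- Z)) * bi_poly b (- g) h n (- Y) (- Z))"
      unfolding bi_op_cmult using one[of "- Y" "- g" "- Z"] Y by simp
    also have "\<dots> = (-1) ^ n * edge_coeff (2 * real n + h
        + 1) g (- ((-1) ^ n)) ((-1) ^ n * Z) * bi_poly b g h n Y Z"
      unfolding bi_poly_neg[OF h] using edge_coeff_neg[of _ g "- ((-1) ^ n)" "(-1) ^ n * Z"]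
      by (cases "even n") simp_all
    finally show ?thesis using 3 by simp
  qed
qed

section \<open>Identification with the Bannai-Ito recurrence\<close>

lemma BI_eq_bi_poly:
  "BI n ((Y - 1) / 4) ((b - g) / 4) ((Z + a - 1) / 4) ((Z - a + 1) / 4) (- (b + g) / 4)
    = bi_poly b g (b + a - 1) n Y Z / 4 ^ n"
proof -
  let ?A = "BI_A ((b - g) / 4) ((Z + a - 1) / 4) ((Z - a + 1) / 4) (- (b + g) / 4)"
  let ?C = "BI_C ((b - g) / 4) ((Z + a - 1) / 4) ((Z - a + 1) / 4) (- (b + g) / 4)"
  \<comment> \<open>Numerator and denominator are doubled together, so the equality holds even where
    the denominator is zero.\<close>
  have frac: "x / (4 * y) = u / v / 4" if "2 * x = u" "2 * y = v" for x y u v :: real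
    using that by (auto simp: field_simps)
  have A: "?A m = bi_A b g (b + a - 1) Z m / 4" for m
    unfolding BI_A_def bi_A_def Let_def
    by (rule frac; cases
        "even m"; simp add: even_iff_mod_2_eq_zero odd_iff_mod_2_eq_one field_simps)
  have C: "?C m = bi_C b g (b + a - 1) Z m / 4" for m
    unfolding BI_C_def bi_C_def Let_def minus_divide_left
    by (rule frac; cases
        "even m"; simp add: even_iff_mod_2_eq_zero odd_iff_mod_2_eq_one field_simps)
  have "BI n ((Y - 1) / 4) \<rho>1 \<rho>2 r1 r2 = bi_poly b g h n Y Z / 4 ^ n"
    if "\<And>m. BI_A \<rho>1 \<rho>2 r1 r2 m = bi_A b g h Z m / 4" "\<And>m. BI_C \<rho>1 \<rho>2 r1 r2 m = bi_C b g h Z m / 4"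
      and "\<rho>1 = (b - g) / 4" for \<rho>1 \<rho>2 r1 r2 h
    by (induction n rule: induct_nat_012) (simp_all add: that(1,2) bi_b_def bi_u_def, simp_all
        add: that(3) field_simps)
  from this[OF A C refl] show ?thesis .
qed

section \<open>The algebra of chained reflection operators\<close>

text \<open>The coefficient of \<open>W b\<close> after \<open>W d\<close> in the commutator of the
  next level's operators with labels 0 and s.\<close>

definition link_coeff_commutator :: "real \<Rightarrow> int \<Rightarrow> real \<Rightarrow> real \<Rightarrow> int \<Rightarrow> int \<Rightarrow> real" where
  "link_coeff_commutator a s Y Z b d = link_coeff a b 0 Y Z * link_coeff a d s (refl_coord b Y) Z
      - link_coeff a b s Y Z * link_coeff a d 0 (refl_coord b Y) (refl_coord s Z)"

text \<open>Products of opposite nonzero labels drop out, and the mixed ones are antisymmetric, so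
  they combine into commutators. The values Y = 3 and Y = -3 are excluded because the second factor
  is read at a reflection of Y.\<close>

lemma link_coeff_commutator:
  fixes a Y Z :: real and s :: int
  assumes Y: "Y \<noteq> 1" "Y \<noteq> -1" "Y \<noteq> 3" "Y \<noteq> -3" and s: "s = 1 \<or> s = -1"
  defines "P \<equiv> link_coeff_commutator a s Y Z"
  shows "P 1 (-1) = 0"
    and "P (-1) 1 = 0"
    and "P 0 1 = (Z + of_int s) * link_coeff a 1 s Y Z / (Y + 1)"
    and "P 0 (-1) = (Z + of_int s) * link_coeff a (-1) s Y Z / (Y - 1)"
    and "P 1 0 = - ((Z + of_int s) * link_coeff a 1 s Y Z / (Y + 1))"
    and "P (-1) 0 = - ((Z + of_int s) * link_coeff a (-1) s Y Z / (Y - 1))"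
    and "P 1 1 = (Y - 1) * (Z + of_int s) * link_coeff a 0 s Y Z / (2 * (Y + 1))"
    and "P (-1) (-1) = - ((Y + 1) * (Z + of_int s) * link_coeff a 0 s Y Z / (2 * (Y - 1)))"
    and "P 0 0 = 2 * Y * (Z + of_int s) * link_coeff a 0 s Y Z / ((Y - 1) * (Y + 1))"
proof -
  have nz: "1 + Y \<noteq> 0" "Y + 1 \<noteq> 0" "1 - Y \<noteq> 0" "Y - 1 \<noteq> 0" "3 + Y \<noteq> 0" "Y + 3 \<noteq> 0" "3 - Y \<noteq> 0" "Y
      - 3 \<noteq> 0"
    "Y \<noteq> 1" "Y \<noteq> 3" "- (2 * Y) \<noteq> 2" "- (2 * Y) - 2 \<noteq> 0"
    using Y by auto
  have den: "- (Y + 1) * (Y - 1) = - ((Y + 1) * (Y - 1))"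
    "- 2 * (1 * Y + 1) = - (2 * (Y + 1))"
    "- 2 * (- 1 * Y + 1) = 2 * (Y - 1)"
    "- ((- Y - 2 * 1) + 1) * ((- Y - 2 * 1) - 1) = - ((Y + 1) * (Y + 3))"
    "- ((- Y - 2 * - 1) + 1) * ((- Y - 2 * - 1) - 1) = - ((Y - 1) * (Y - 3))"
    "- 2 * (1 * (- Y - 2 * 1) + 1) = 2 * (Y + 1)"
    "- 2 * (1 * (- Y - 2 * - 1) + 1) = 2 * (Y - 3)"
    "- 2 * (- 1 * (- Y - 2 * 1) + 1) = - (2 * (Y + 3))"
    "- 2 * (- 1 * (- Y - 2 * - 1) + 1) = - (2 * (Y - 1))"
    by algebra+
  have *: "of_int 1 = (1::real)" "of_int (-1) = (-1::real)" "(0::int) \<noteq> 1" "(1::int) \<noteq> 0"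
      "(0::int) \<noteq> -1" "(-1::int) \<noteq> 0"
    by simp_all
  note defs = link_coeff_def refl_coord_def
  have cases: "Q s" if "Q 1" "Q (-1)" for Q :: "int \<Rightarrow> bool" using s that by auto
  show "P 1 (-1) = 0"
    unfolding P_def link_coeff_commutator_def
    by (rule cases; simp only: defs * if_True if_False simp_thms den; (simp add: divide_simps
        nz)?; algebra?)
  show "P (-1) 1 = 0"
    unfolding P_def link_coeff_commutator_def
    by (rule cases; simp only: defs * if_True if_False simp_thms den; (simp add: divide_simps
        nz)?; algebra?)
  show "P 0 1 = (Z + of_int s) * link_coeff a 1 s Y Z / (Y + 1)"
    unfolding P_def link_coeff_commutator_def
    by (rule cases; simp only: defs * if_True if_False simp_thms den; (simp add: divide_simps
        nz)?; algebra?)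
  show "P 0 (-1) = (Z + of_int s) * link_coeff a (-1) s Y Z / (Y - 1)"
    unfolding P_def link_coeff_commutator_def
    by (rule cases; simp only: defs * if_True if_False simp_thms den; (simp add: divide_simps
        nz)?; algebra?)
  show "P 1 0 = - ((Z + of_int s) * link_coeff a 1 s Y Z / (Y + 1))"
    unfolding P_def link_coeff_commutator_def
    by (rule cases; simp only: defs * if_True if_False simp_thms den; (simp add: divide_simps
        nz)?; algebra?)
  show "P (-1) 0 = - ((Z + of_int s) * link_coeff a (-1) s Y Z / (Y - 1))"
    unfolding P_def link_coeff_commutator_def
    by (rule cases; simp only: defs * if_True if_False simp_thms den; (simp add: divide_simps
        nz)?; algebra?)
  show "P 1 1 = (Y - 1) * (Z + of_int s) * link_coeff a 0 s Y Z / (2 * (Y + 1))"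
    unfolding P_def link_coeff_commutator_def
    by (rule cases; simp only: defs * if_True if_False simp_thms den; (simp add: divide_simps
        nz)?; algebra?)
  show "P (-1) (-1) = - ((Y + 1) * (Z + of_int s) * link_coeff a 0 s Y Z / (2 * (Y - 1)))"
    unfolding P_def link_coeff_commutator_def
    by (rule cases; simp only: defs * if_True if_False simp_thms den; (simp add: divide_simps
        nz)?; algebra?)
  show "P 0 0 = 2 * Y * (Z + of_int s) * link_coeff a 0 s Y Z / ((Y - 1) * (Y + 1))"
    unfolding P_def link_coeff_commutator_def
    by (rule cases; simp only: defs * if_True if_False simp_thms den; (simp add: divide_simps
        nz)?; algebra?)
qed

text \<open>The analogous coefficient in the square of the label s operator minus the square of the
  label 0 operator.\<close>

definition link_coeff_square :: "real \<Rightarrow> int \<Rightarrow> real \<Rightarrow> real \<Rightarrow> int \<Rightarrow> int \<Rightarrow> real" where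
  "link_coeff_square a s Y Z b d
      = link_coeff a b s Y Z * link_coeff a d s (refl_coord b Y) (refl_coord s Z)
      - link_coeff a b 0 Y Z * link_coeff a d 0 (refl_coord b Y) Z"

lemma link_coeff_square:
  fixes a Y Z :: real and s :: int
  assumes Y: "Y \<noteq> 1" "Y \<noteq> -1" "Y \<noteq> 3" "Y \<noteq> -3" and s: "s = 1 \<or> s = -1"
  defines "T \<equiv> link_coeff_square a s Y Z"
  shows "T 1 (-1) = 0"
    and "T (-1) 1 = 0"
    and "T 0 1 = - ((Z + of_int s) * link_coeff a 1 0 Y Z / (Y + 1))"
    and "T 0 (-1) = - ((Z + of_int s) * link_coeff a (-1) 0 Y Z / (Y - 1))"
    and "T 1 0 = (Z + of_int s) * link_coeff a 1 0 Y Z / (Y + 1)"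
    and "T (-1) 0 = (Z + of_int s) * link_coeff a (-1) 0 Y Z / (Y - 1)"
    and "T 1 1 = (Z + of_int s) * ((Z + of_int s) - (Y - 1) * link_coeff a 0 0 Y Z) / (2 * (Y + 1))"
    and "T (-1) (-1) = - ((Z + of_int s) * ((Z + of_int s) - (Y
        + 1) * link_coeff a 0 0 Y Z) / (2 * (Y - 1)))"
    and "T 0 0 = (Z + of_int s) * ((Z + of_int s) - 2 * Y * link_coeff a 0 0 Y Z) / ((Y - 1) * (Y
        + 1))"
proof -
  have nz: "1 + Y \<noteq> 0" "Y + 1 \<noteq> 0" "1 - Y \<noteq> 0" "Y - 1 \<noteq> 0" "3 + Y \<noteq> 0" "Y + 3 \<noteq> 0" "3 - Y \<noteq> 0" "Y
      - 3 \<noteq> 0"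
    "Y \<noteq> 1" "Y \<noteq> 3" "- (2 * Y) \<noteq> 2" "- (2 * Y) - 2 \<noteq> 0"
    using Y by auto
  have den: "- (Y + 1) * (Y - 1) = - ((Y + 1) * (Y - 1))"
    "- 2 * (1 * Y + 1) = - (2 * (Y + 1))"
    "- 2 * (- 1 * Y + 1) = 2 * (Y - 1)"
    "- ((- Y - 2 * 1) + 1) * ((- Y - 2 * 1) - 1) = - ((Y + 1) * (Y + 3))"
    "- ((- Y - 2 * - 1) + 1) * ((- Y - 2 * - 1) - 1) = - ((Y - 1) * (Y - 3))"
    "- 2 * (1 * (- Y - 2 * 1) + 1) = 2 * (Y + 1)"
    "- 2 * (1 * (- Y - 2 * - 1) + 1) = 2 * (Y - 3)"
    "- 2 * (- 1 * (- Y - 2 * 1) + 1) = - (2 * (Y + 3))"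
    "- 2 * (- 1 * (- Y - 2 * - 1) + 1) = - (2 * (Y - 1))"
    by algebra+
  have *: "of_int 1 = (1::real)" "of_int (-1) = (-1::real)" "(0::int) \<noteq> 1" "(1::int) \<noteq> 0"
      "(0::int) \<noteq> -1" "(-1::int) \<noteq> 0"
    by simp_all
  note defs = link_coeff_def refl_coord_def
  have cases: "Q s" if "Q 1" "Q (-1)" for Q :: "int \<Rightarrow> bool" using s that by auto
  show "T 1 (-1) = 0"
    unfolding T_def link_coeff_square_def
    by (rule cases; simp only: defs * if_True if_False simp_thms den; (simp add: divide_simps
        nz)?; algebra?)
  show "T (-1) 1 = 0"
    unfolding T_def link_coeff_square_def
    by (rule cases; simp only: defs * if_True if_False simp_thms den; (simp add: divide_simps
        nz)?; algebra?)
  show "T 0 1 = - ((Z + of_int s) * link_coeff a 1 0 Y Z / (Y + 1))"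
    unfolding T_def link_coeff_square_def
    by (rule cases; simp only: defs * if_True if_False simp_thms den; (simp add: divide_simps
        nz)?; algebra?)
  show "T 0 (-1) = - ((Z + of_int s) * link_coeff a (-1) 0 Y Z / (Y - 1))"
    unfolding T_def link_coeff_square_def
    by (rule cases; simp only: defs * if_True if_False simp_thms den; (simp add: divide_simps
        nz)?; algebra?)
  show "T 1 0 = (Z + of_int s) * link_coeff a 1 0 Y Z / (Y + 1)"
    unfolding T_def link_coeff_square_def
    by (rule cases; simp only: defs * if_True if_False simp_thms den; (simp add: divide_simps
        nz)?; algebra?)
  show "T (-1) 0 = (Z + of_int s) * link_coeff a (-1) 0 Y Z / (Y - 1)"
    unfolding T_def link_coeff_square_def
    by (rule cases; simp only: defs * if_True if_False simp_thms den; (simp add: divide_simps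
        nz)?; algebra?)
  show "T 1 1 = (Z + of_int s) * ((Z + of_int s) - (Y - 1) * link_coeff a 0 0 Y Z) / (2 * (Y + 1))"
    unfolding T_def link_coeff_square_def
    by (rule cases; simp only: defs * if_True if_False simp_thms den; (simp add: divide_simps
        nz)?; algebra?)
  show "T (-1) (-1) = - ((Z + of_int s) * ((Z + of_int s) - (Y
      + 1) * link_coeff a 0 0 Y Z) / (2 * (Y - 1)))"
    unfolding T_def link_coeff_square_def
    by (rule cases; simp only: defs * if_True if_False simp_thms den; (simp add: divide_simps
        nz)?; algebra?)
  show "T 0 0 = (Z + of_int s) * ((Z + of_int s) - 2 * Y * link_coeff a 0 0 Y Z) / ((Y - 1) * (Y
      + 1))"
    unfolding T_def link_coeff_square_def
    by (rule cases; simp only: defs * if_True if_False simp_thms den; (simp add: divide_simps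
        nz)?; algebra?)
qed

section \<open>Path operators in several variables\<close>

definition ycoord :: "(nat \<Rightarrow> real) \<Rightarrow> nat \<Rightarrow> point \<Rightarrow> real" where
  "ycoord \<alpha> k x = (-1) powi x k * (2 * real_of_int (x k) + asum \<alpha> 1 k)"

definition reflect :: "nat \<Rightarrow> int \<Rightarrow> point \<Rightarrow> point" where
  "reflect k A x = x(k := x k + A * (if even (x k) then 1 else -1))"

text \<open>Level k coefficients involve only coordinates up to k + 1, so applying the shift of
  coordinate k + 2 before the level k operator leaves them unchanged and affects only the argument
  of f.\<close>

primrec path_op :: "(nat \<Rightarrow> real) \<Rightarrow> real \<Rightarrow> nat \<Rightarrow> int \<Rightarrow> (point \<Rightarrow> real) \<Rightarrow> point \<Rightarrow> real" where
  "path_op \<alpha> \<beta> 0 A f x = edge_coeff \<beta> (\<beta> - \<alpha> 1 + 1) A (ycoord \<alpha> 1 x) * f (reflect 1 A x)"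
| "path_op \<alpha> \<beta> (Suc k) B f x =
     (\<Sum>A\<in>{-1, 0, 1}. link_coeff (\<alpha> (k + 2)) A B (ycoord \<alpha> (k + 1) x) (ycoord \<alpha> (k + 2) x)
        * path_op \<alpha> \<beta> k A f (reflect (k + 2) B x))"

lemma minus_one_powi: "(-1) powi m = (if even m then 1 else (-1 :: real))"
  by (simp add: power_int_minus_left)

lemma ycoord_reflect:
  assumes "A \<in> {-1, 0, 1}"
  shows "ycoord \<alpha> k (reflect k A x) = refl_coord A (ycoord \<alpha> k x)"
  using assms by (auto simp: ycoord_def reflect_def refl_coord_def minus_one_powi)

lemma ycoord_reflect_other [simp]: "l \<noteq> k \<Longrightarrow> ycoord \<alpha> l (reflect k A x) = ycoord \<alpha> l x"
  by (simp add: ycoord_def reflect_def)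

lemma reflect_0 [simp]: "reflect k 0 x = x"
  by (simp add: reflect_def)

lemma reflect_reflect: "A \<in> {-1, 1} \<Longrightarrow> reflect k A (reflect k A x) = x"
  by (auto simp: reflect_def)

lemma reflect_commute: "k \<noteq> l \<Longrightarrow> reflect k A (reflect l B x) = reflect l B (reflect k A x)"
  by (auto simp: reflect_def fun_upd_twist)

lemma path_op_add: "path_op \<alpha> \<beta> k A (\<lambda>z. f z + h z) x = path_op \<alpha> \<beta> k A f x + path_op \<alpha> \<beta> k A h x"
  by (induction k arbitrary: A x) (simp_all add: algebra_simps)

lemma path_op_cmult: "path_op \<alpha> \<beta> k A (\<lambda>z. c * f z) x = c * path_op \<alpha> \<beta> k A f x"
  by (induction k arbitrary: A x) (simp_all add: algebra_simps)

lemma path_op_reflect: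
  assumes "m > k + 1"
  shows "path_op \<alpha> \<beta> k A (\<lambda>z. f (reflect m B z)) x = path_op \<alpha> \<beta> k A f (reflect m B x)"
  using assms
  by (induction k arbitrary: A x) (simp_all add: reflect_commute[of m])

lemma path_op_mult:
  assumes "\<And>l C z. l \<in> {1..k} \<Longrightarrow> h (reflect l C z) = h z"
  shows "path_op \<alpha> \<beta> k A (\<lambda>z. h z * f z) x = h (reflect (k + 1) A x) * path_op \<alpha> \<beta> k A f x"
  using assms
proof (induction k arbitrary: A x)
  case (Suc k)
  have "path_op \<alpha> \<beta> k C (\<lambda>z. h z * f z) (reflect (k + 2) A x) = h (reflect (k
      + 2) A x) * path_op \<alpha> \<beta> k C f (reflect (k + 2) A x)" for C
    using Suc.IH[of C "reflect (k + 2) A x"] Suc.prems(1)[of "k + 1"] Suc.prems by simp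
  then show ?case by (simp add: algebra_simps)
qed simp

definition path_casimir :: "(nat \<Rightarrow> real) \<Rightarrow> real \<Rightarrow> nat \<Rightarrow> (point \<Rightarrow> real) \<Rightarrow> point \<Rightarrow> real" where
  "path_casimir \<alpha> \<beta> k f x = path_op \<alpha> \<beta> k 0 f x - (\<beta> - \<alpha> 1 + 1) / 2 * ycoord \<alpha> (k + 1) x * f x"

text \<open>A product of two operators evaluates the coefficients, with poles at \<open>Y = \<plusminus>1\<close>, at the reflections
  of \<open>Y\<close> as well; this adds \<open>\<plusminus>3\<close>.\<close>

definition regular_point :: "(nat \<Rightarrow> real) \<Rightarrow> nat \<Rightarrow> point \<Rightarrow> bool" where
  "regular_point \<alpha> k x \<longleftrightarrow> (\<forall>l\<in>{1..k}. ycoord \<alpha> l x \<notin> {1, -1, 3, -3})"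

text \<open>The inner coefficients are read after the outer step, hence at reflected Y and Z; they
  do not involve the first k coordinates, so \<open>path_op_mult\<close> extracts them.\<close>

lemma path_op_path_op:
  assumes "A \<in> {-1, 0, 1}" "B \<in> {-1, 0, 1}"
  shows "path_op \<alpha> \<beta> (Suc k) A (path_op \<alpha> \<beta> (Suc k) B f) x =
    (\<Sum>b\<in>{-1, 0, 1}. \<Sum>d\<in>{-1, 0, 1}.
       link_coeff (\<alpha> (k + 2)) b A (ycoord \<alpha> (k + 1) x) (ycoord \<alpha> (k + 2) x)
       * link_coeff (\<alpha> (k + 2)) d B (refl_coord b (ycoord \<alpha> (k + 1) x)) (refl_coord A (ycoord \<alpha> (k
           + 2) x))
       * path_op \<alpha> \<beta> k b (path_op \<alpha> \<beta> k d f) (reflect (k + 2) B (reflect (k + 2) A x)))"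
proof -
  have inner: "path_op \<alpha> \<beta> k b (\<lambda>z. link_coeff (\<alpha> (k + 2)) d B (ycoord \<alpha> (k + 1) z) (ycoord \<alpha> (k
      + 2) z)
        * path_op \<alpha> \<beta> k d f (reflect (k + 2) B z)) (reflect (k + 2) A x)
     = link_coeff (\<alpha> (k + 2)) d B (refl_coord b (ycoord \<alpha> (k + 1) x)) (refl_coord A (ycoord \<alpha> (k
         + 2) x))
       * path_op \<alpha> \<beta> k b (path_op \<alpha> \<beta> k d f) (reflect (k + 2) B (reflect (k + 2) A x))"
    if "b \<in> {-1, 0, 1}" for b d
    using that assms
    by (subst path_op_mult) (auto simp: ycoord_reflect path_op_reflect)
  have "path_op \<alpha> \<beta> (Suc k) B f = (\<lambda>z.
      link_coeff (\<alpha> (k + 2)) (-1) B (ycoord \<alpha> (k + 1) z) (ycoord \<alpha> (k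
          + 2) z) * path_op \<alpha> \<beta> k (-1) f (reflect (k + 2) B z)
      + (link_coeff (\<alpha> (k + 2)) 0 B (ycoord \<alpha> (k + 1) z) (ycoord \<alpha> (k
          + 2) z) * path_op \<alpha> \<beta> k 0 f (reflect (k + 2) B z)
      + link_coeff (\<alpha> (k + 2)) 1 B (ycoord \<alpha> (k + 1) z) (ycoord \<alpha> (k
          + 2) z) * path_op \<alpha> \<beta> k 1 f (reflect (k + 2) B z)))"
    by (rule ext) simp
  then have "path_op \<alpha> \<beta> k b (path_op \<alpha> \<beta> (Suc k) B f) (reflect (k + 2) A x) = (\<Sum>d\<in>{-1, 0, 1}.
       link_coeff (\<alpha> (k + 2)) d B (refl_coord b (ycoord \<alpha> (k + 1) x)) (refl_coord A (ycoord \<alpha> (k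
           + 2) x))
       * path_op \<alpha> \<beta> k b (path_op \<alpha> \<beta> k d f) (reflect (k + 2) B (reflect (k + 2) A x)))"
    if "b \<in> {-1, 0, 1}" for b
    using inner[OF that] by (simp only: path_op_add) simp
  then show ?thesis
    unfolding path_op.simps(2)[of \<alpha> \<beta> k A]
    by (intro sum.cong) (simp_all add: distrib_left mult.assoc)
qed

text \<open>In the next two identities \<open>h\<close>, \<open>h1\<close>, \<open>h2\<close> stand for \<open>f\<close>, \<open>\<Lambda> f\<close>, \<open>\<Lambda>\<^sup>2 f\<close> at a point: they collect
  the terms that return to that point.\<close>

lemma comm_scalar:
  fixes Y :: real
  assumes nz: "Y + 1 \<noteq> 0" "Y - 1 \<noteq> 0"
  shows "(Y - 1) * S * k / (2 * (Y + 1)) * ((g\<^sup>2 * h - 4 * g * h1 + 4 * h2 - (Y + 1)\<^sup>2 * h) / 4)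
    - (Y + 1) * S * k / (2 * (Y - 1)) * ((g\<^sup>2 * h + 4 * g * h1 + 4 * h2 - (Y - 1)\<^sup>2 * h) / 4)
    + 2 * Y * S * k / ((Y - 1) * (Y + 1)) * (h2 + g * Y * h1 + g\<^sup>2 * Y\<^sup>2 / 4 * h)
    = g * S * (k * (h1 + g * Y / 2 * h))"
proof -
  have nz': "1 + Y \<noteq> 0" "Y \<noteq> 1" "2 * Y - 2 \<noteq> 0" "2 + 2 * Y \<noteq> 0" "2 * Y + 2 \<noteq> 0"
    "8 * Y + 8 \<noteq> 0" "8 * Y - 8 \<noteq> 0" using nz by auto
  show ?thesis by (simp add: divide_simps nz nz', algebra)
qed

lemma square_scalar:
  fixes Y :: real
  assumes nz: "Y + 1 \<noteq> 0" "Y - 1 \<noteq> 0"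
  shows "S * (S - (Y - 1) * n) / (2 * (Y + 1)) * ((g\<^sup>2 * h - 4 * g * h1 + 4 * h2 - (Y
      + 1)\<^sup>2 * h) / 4)
    - S * (S - (Y + 1) * n) / (2 * (Y - 1)) * ((g\<^sup>2 * h + 4 * g * h1 + 4 * h2 - (Y - 1)\<^sup>2 * h) / 4)
    + S * (S - 2 * Y * n) / ((Y - 1) * (Y + 1)) * (h2 + g * Y * h1 + g\<^sup>2 * Y\<^sup>2 / 4 * h)
    = S\<^sup>2 * (g\<^sup>2 - 1) / 4 * h - g * S * (n * (h1 + g * Y / 2 * h))"
proof -
  have nz': "1 + Y \<noteq> 0" "Y \<noteq> 1" "2 * Y - 2 \<noteq> 0" "2 + 2 * Y \<noteq> 0" "2 * Y + 2 \<noteq> 0"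
    "8 * Y + 8 \<noteq> 0" "8 * Y - 8 \<noteq> 0" using nz by auto
  show ?thesis by (simp add: divide_simps nz nz', algebra)
qed

lemma path_op_0_eq: "path_op \<alpha> \<beta> k 0 f = (\<lambda>z. path_casimir \<alpha> \<beta> k f z + (\<beta> - \<alpha> 1
    + 1) / 2 * ycoord \<alpha> (k + 1) z * f z)"
  by (simp add: path_casimir_def fun_eq_iff)

lemma path_op_ycoord:
  assumes "A \<in> {-1, 0, 1}"
  shows "path_op \<alpha> \<beta> k A (\<lambda>z. c * ycoord \<alpha> (k + 1) z * f z) x = c * refl_coord A (ycoord \<alpha> (k
      + 1) x) * path_op \<alpha> \<beta> k A f x"
  using assms by (subst path_op_mult) (auto simp: ycoord_reflect)

lemma path_casimir_alt:
  "path_casimir \<alpha> \<beta> k f = (\<lambda>z. path_op \<alpha> \<beta> k 0 f z + (- (\<beta> - \<alpha> 1 + 1) / 2) * ycoord \<alpha> (k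
      + 1) z * f z)"
  by (simp add: path_casimir_def fun_eq_iff field_simps)

lemma path_op_path_casimir:
  assumes "A \<in> {-1, 0, 1}"
  shows "path_op \<alpha> \<beta> k A (path_casimir \<alpha> \<beta> k f) x = path_op \<alpha> \<beta> k A (path_op \<alpha> \<beta> k 0 f) x
    - (\<beta> - \<alpha> 1 + 1) / 2 * refl_coord A (ycoord \<alpha> (k + 1) x) * path_op \<alpha> \<beta> k A f x"
  unfolding path_casimir_alt[of \<alpha> \<beta> k f] path_op_add path_op_ycoord[OF assms]
      by (simp add: field_simps)

lemma path_op_path_op_0:
  assumes "A \<in> {-1, 0, 1}"
  shows "path_op \<alpha> \<beta> k A (path_op \<alpha> \<beta> k 0 f) x = path_op \<alpha> \<beta> k A (path_casimir \<alpha> \<beta> k f) x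
    + (\<beta> - \<alpha> 1 + 1) / 2 * refl_coord A (ycoord \<alpha> (k + 1) x) * path_op \<alpha> \<beta> k A f x"
  using path_op_path_casimir[OF assms] by simp

text \<open>The two relations are proved jointly: each one at level k + 1 uses both at level
  k.\<close>

lemma path_op_relations:
  fixes \<alpha> :: "nat \<Rightarrow> real" and \<beta> :: real
  defines "g \<equiv> \<beta> - \<alpha> 1 + 1"
  assumes "regular_point \<alpha> k x" and "s \<in> {-1, 1}"
  shows "path_casimir \<alpha> \<beta> k (path_op \<alpha> \<beta> k s f) x = path_op \<alpha> \<beta> k s (path_casimir \<alpha> \<beta> k f) x \<and>
    4 * path_op \<alpha> \<beta> k s (path_op \<alpha> \<beta> k s f) x =
      g\<^sup>2 * f x - 4 * of_int s * g * path_casimir \<alpha> \<beta> k f x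
          + 4 * path_casimir \<alpha> \<beta> k (path_casimir \<alpha> \<beta> k f) x
      - (ycoord \<alpha> (k + 1) x + of_int s)\<^sup>2 * f x"
  using assms(2-)
proof (induction k arbitrary: x f s)
  case 0
  \<comment> \<open>At level 0 the terms in Y cancel and the Casimir is a constant.\<close>
  have casimir_0: "path_casimir \<alpha> \<beta> 0 f = (\<lambda>z. - \<beta> / 2 * f z)" for f
    by (simp add: path_casimir_def edge_coeff_def fun_eq_iff field_simps)
  show ?case
    using 0 unfolding casimir_0 path_op_cmult
    by (auto simp: edge_coeff_def refl_coord_def ycoord_reflect reflect_reflect g_def
        power2_eq_square field_simps)
next
  case (Suc k)
  have *: "s = 1 \<or> s = -1" "s \<in> {-1, 0, 1}" "0 \<in> {-1, 0, 1::int}" using Suc.prems by auto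
  let ?W = "path_op \<alpha> \<beta> k" and ?L = "path_casimir \<alpha> \<beta> k" and ?V = "path_op \<alpha> \<beta> (Suc k)" and ?M =
      "path_casimir \<alpha> \<beta> (Suc k)"
  define a where "a = \<alpha> (k + 2)"
  define Y where "Y = ycoord \<alpha> (k + 1) x"
  define Z where "Z = ycoord \<alpha> (k + 2) x"
  define S where "S = Z + of_int s"
  have Y: "Y \<noteq> 1" "Y \<noteq> -1" "Y \<noteq> 3" "Y \<noteq> -3" using Suc.prems by (auto simp: regular_point_def Y_def)
  then have Ynz: "Y + 1 \<noteq> 0" "Y - 1 \<noteq> 0" by auto
  have refl_Z: "Z - refl_coord s Z = 2 * S" using * by (auto simp: refl_coord_def S_def)
  have rel: "?W 0 (?W d f) y = ?W d (?L f) y + g / 2 * Y * ?W d f y"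
    "?W d (?W 0 f) y = ?W d (?L f) y + g / 2 * refl_coord d Y * ?W d f y"
    "?W d (?W d f) y = (g\<^sup>2 * f y - 4 * of_int d * g * ?L f y + 4 * ?L (?L f) y - (Y
        + of_int d)\<^sup>2 * f y) / 4"
    "?W 0 (?W 0 f) y = ?L (?L f) y + g * Y * ?L f y + g\<^sup>2 * Y\<^sup>2 / 4 * f y"
    "?W 0 f y = ?L f y + g * Y / 2 * f y"
    if "y = reflect (k + 2) A x" "d \<in> {-1, 1}" for y A d
  proof -
    have ns: "regular_point \<alpha> k y" and yY: "ycoord \<alpha> (k + 1) y = Y"
      using Suc.prems that(1) by (auto simp: regular_point_def Y_def)
    have d: "d \<in> {-1, 0, 1}" using that by auto
    note IH = Suc.IH[OF ns that(2), of f, THEN conjunct1] Suc.IH[OF ns that(2), of f, THEN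
        conjunct2]
    show "?W 0 (?W d f) y = ?W d (?L f) y + g / 2 * Y * ?W d f y"
      using IH(1) yY by (simp add: path_op_0_eq g_def)
    show "?W d (?W 0 f) y = ?W d (?L f) y + g / 2 * refl_coord d Y * ?W d f y"
      unfolding path_op_path_op_0[OF d] yY g_def ..
    show "?W d (?W d f) y = (g\<^sup>2 * f y - 4 * of_int d * g * ?L f y + 4 * ?L (?L f) y - (Y
        + of_int d)\<^sup>2 * f y) / 4"
      using IH(2) unfolding yY by simp
    show 0: "?W 0 f y = ?L f y + g * Y / 2 * f y" for f
      using yY by (simp add: path_op_0_eq g_def)
    show "?W 0 (?W 0 f) y = ?L (?L f) y + g * Y * ?L f y + g\<^sup>2 * Y\<^sup>2 / 4 * f y"
      unfolding path_op_path_op_0[OF *(3)] yY 0 g_def[symmetric]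
      by (simp add: refl_coord_def power2_eq_square field_simps)
  qed
  have pm: "1 \<in> {-1, 1 :: int}" "-1 \<in> {-1, 1 :: int}" by simp_all
  \<comment> \<open>The Casimir commutes with \<open>?W d\<close>, so only the multiplication by
    \<open>g / 2 * Y\<close> inside \<open>?W 0\<close> contributes.\<close>
  have diff: "?W 0 (?W 1 f) y - ?W 1 (?W 0 f) y = g * (Y + 1) * ?W 1 f y"
    "?W 0 (?W (-1) f) y - ?W (-1) (?W 0 f) y = g * (Y - 1) * ?W (-1) f y"
    if "y = reflect (k + 2) A x" for y A
    using rel(1,2)[OF that, of 1] rel(1,2)[OF that, of "-1"]
        by (simp_all add: refl_coord_def field_simps)
  have M_eq: "?M h x = ?V 0 h x - g / 2 * Z * h x" for h
    by (simp add: path_casimir_def g_def Z_def del: path_op.simps)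
  have V_M: "?V A (?M f) x = ?V A (?V 0 f) x - g / 2 * refl_coord A Z * ?V A f x" if
      "A \<in> {-1, 0, 1}" for A
    using path_op_path_casimir[OF that, of \<alpha> \<beta> "Suc k" f x]
        by (simp add: g_def Z_def del: path_op.simps)
  note WW = path_op_path_op[of _ _ \<alpha> \<beta> k f x, folded a_def Y_def Z_def]
  show ?case
  proof
    define y where "y = reflect (k + 2) s x"
    define P where "P = link_coeff_commutator a s Y Z"
    note P = link_coeff_commutator[OF Y *(1), of a Z, folded P_def S_def]
    have P0: "P 1 0 = - P 0 1" "P (-1) 0 = - P 0 (-1)" using P(3-6) by simp_all
    note dW = diff[OF y_def] and sq
        = rel(3)[OF y_def pm(1)] rel(3)[OF y_def pm(2)] rel(4)[OF y_def pm(1)]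
      and W0 = rel(5)[OF y_def pm(1)]
    have Vs: "?V s f x = link_coeff a (-1) s Y Z * ?W (-1) f y + link_coeff a 0 s Y Z * ?W 0 f y
        + link_coeff a 1 s Y Z * ?W 1 f y"
      by (simp add: y_def a_def Y_def Z_def)
    have "?V 0 (?V s f) x - ?V s (?V 0 f) x
        = (\<Sum>b\<in>{-1, 0, 1}. \<Sum>d\<in>{-1, 0, 1}. P b d * ?W b (?W d f) y)"
      unfolding WW[OF *(2,3)] WW[OF *(3,2)] P_def link_coeff_commutator_def
      by (simp add: y_def[symmetric] left_diff_distrib) (simp add: refl_coord_def y_def)
    also have "\<dots> = g * S * ?V s f x"
    proof -
      \<comment> \<open>Nine products collapse to two commutators and one combination of
        squares.\<close>
      have "(\<Sum>b\<in>{-1, 0, 1}. \<Sum>d\<in>{-1, 0, 1}. P b d * ?W b (?W d f) y) =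
          P 0 1 * (?W 0 (?W 1 f) y - ?W 1 (?W 0 f) y) + P 0 (-1) * (?W 0 (?W (-1) f) y
              - ?W (-1) (?W 0 f) y)
          + (P 1 1 * ?W 1 (?W 1 f) y + P (-1) (-1) * ?W (-1) (?W (-1) f) y
              + P 0 0 * ?W 0 (?W 0 f) y)"
        using P(1,2) P0 by (simp add: algebra_simps)
      also have "P 0 1 * (?W 0 (?W 1 f) y - ?W 1 (?W 0 f) y)
          = g * S * (link_coeff a 1 s Y Z * ?W 1 f y)"
        unfolding dW P(3) using Ynz by simp
      also have "P 0 (-1) * (?W 0 (?W (-1) f) y - ?W (-1) (?W 0 f) y)
          = g * S * (link_coeff a (-1) s Y Z * ?W (-1) f y)"
        unfolding dW P(4) using Ynz by simp
      also have "P 1 1 * ?W 1 (?W 1 f) y + P (-1) (-1) * ?W (-1) (?W (-1) f) y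
          + P 0 0 * ?W 0 (?W 0 f) y
          = g * S * (link_coeff a 0 s Y Z * (?L f y + g * Y / 2 * f y))"
        using comm_scalar[OF Ynz, of S "link_coeff a 0 s Y Z" g "f y" "?L f y" "?L (?L f) y"]
        unfolding P(7-9) sq by simp
      finally show ?thesis unfolding Vs W0 by (simp add: algebra_simps del: path_op.simps)
    qed
    \<comment> \<open>The commutator \<open>g * S * ?V s\<close> is cancelled by the one coming from
      \<open>g / 2 * Z\<close>, since reflecting Z changes it by \<open>2 * S\<close>.\<close>
    finally show "?M (?V s f) x = ?V s (?M f) x"
      using refl_Z unfolding M_eq V_M[OF *(2)] by algebra
  next
    show "4 * ?V s (?V s f) x = g\<^sup>2 * f x - 4 * of_int s * g * ?M f x + 4 * ?M (?M f) x
        - (ycoord \<alpha> (Suc k + 1) x + of_int s)\<^sup>2 * f x"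
    proof -
      define T where "T = link_coeff_square a s Y Z"
      note T = link_coeff_square[OF Y *(1), of a Z, folded T_def S_def]
      have T0: "T 1 0 = - T 0 1" "T (-1) 0 = - T 0 (-1)" using T(3-6) by simp_all
      have x: "x = reflect (k + 2) 0 x" by simp
      have xx: "reflect (k + 2) s (reflect (k + 2) s x) = x" using Suc.prems(2)
          by (rule reflect_reflect)
      note dW = diff[OF x] and sq = rel(3)[OF x pm(1)] rel(3)[OF x pm(2)] rel(4)[OF x pm(1)]
        and W0 = rel(5)[OF x pm(1)]
      have V0: "?V 0 f x = link_coeff a (-1) 0 Y Z * ?W (-1) f x + link_coeff a 0 0 Y Z * ?W 0 f x
          + link_coeff a 1 0 Y Z * ?W 1 f x"
        by (simp add: a_def Y_def Z_def)
      have "?V s (?V s f) x - ?V 0 (?V 0 f) x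
          = (\<Sum>b\<in>{-1, 0, 1}. \<Sum>d\<in>{-1, 0, 1}. T b d * ?W b (?W d f) x)"
        unfolding WW[OF *(2,2)] WW[OF *(3,3)] T_def link_coeff_square_def xx
        by (simp add: left_diff_distrib) (simp add: refl_coord_def)
      also have "\<dots> = T 0 1 * (?W 0 (?W 1 f) x - ?W 1 (?W 0 f) x) + T 0 (-1) * (?W 0 (?W (-1) f) x
          - ?W (-1) (?W 0 f) x)
          + (T 1 1 * ?W 1 (?W 1 f) x + T (-1) (-1) * ?W (-1) (?W (-1) f) x
              + T 0 0 * ?W 0 (?W 0 f) x)"
        using T(1,2) T0 by (simp add: algebra_simps)
      also have "T 0 1 * (?W 0 (?W 1 f) x - ?W 1 (?W 0 f) x) =
          - g * S * (link_coeff a 1 0 Y Z * ?W 1 f x)"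
        unfolding dW T(3) using Ynz by simp
      also have "T 0 (-1) * (?W 0 (?W (-1) f) x - ?W (-1) (?W 0 f) x) =
          - g * S * (link_coeff a (-1) 0 Y Z * ?W (-1) f x)"
        unfolding dW T(4) using Ynz by simp
      also have "T 1 1 * ?W 1 (?W 1 f) x + T (-1) (-1) * ?W (-1) (?W (-1) f) x
          + T 0 0 * ?W 0 (?W 0 f) x
          = S\<^sup>2 * (g\<^sup>2 - 1) / 4 * f x - g * S * (link_coeff a 0 0 Y Z * (?L f x + g * Y / 2 * f x))"
        using square_scalar[OF Ynz, of S "link_coeff a 0 0 Y Z" g "f x" "?L f x" "?L (?L f) x"]
        unfolding T(7-9) sq by simp
      finally have "?V s (?V s f) x = ?V 0 (?V 0 f) x - g * S * ?V 0 f x + S\<^sup>2 * (g\<^sup>2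
          - 1) / 4 * f x"
        unfolding V0 W0 by (simp add: field_simps del: path_op.simps)
      moreover have "?M f x = ?V 0 f x - g / 2 * Z * f x"
        "?M (?M f) x = ?V 0 (?V 0 f) x - g * Z * ?V 0 f x + g\<^sup>2 / 4 * Z\<^sup>2 * f x"
        unfolding M_eq V_M[OF *(3)]
            by (simp_all add: refl_coord_def power2_eq_square field_simps del: path_op.simps)
      moreover have "ycoord \<alpha> (Suc k + 1) x = Z" "(of_int s)\<^sup>2 = (1 :: real)"
        using * by (auto simp: Z_def)
      ultimately show ?thesis
        unfolding S_def by algebra
    qed
  qed
qed

section \<open>The operators of the proposition\<close>

lemma path_casimir_add: "path_casimir \<alpha> \<beta> k (\<lambda>z. f z + h z) x = path_casimir \<alpha> \<beta> k f x
    + path_casimir \<alpha> \<beta> k h x"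
  by (simp add: path_casimir_def path_op_add field_simps)

lemma path_casimir_cmult: "path_casimir \<alpha> \<beta> k (\<lambda>z. c * f z) x = c * path_casimir \<alpha> \<beta> k f x"
  by (simp add: path_casimir_def path_op_cmult algebra_simps)

lemma path_casimir_mult:
  assumes "\<And>l C z. l \<in> {1..k} \<Longrightarrow> h (reflect l C z) = h z"
  shows "path_casimir \<alpha> \<beta> k (\<lambda>z. h z * f z) x = h x * path_casimir \<alpha> \<beta> k f x"
  using path_op_mult[of k h \<alpha> \<beta> 0 f x] assms by (simp add: path_casimir_def algebra_simps)

lemma path_casimir_reflect:
  assumes "m > k + 1"
  shows "path_casimir \<alpha> \<beta> k (\<lambda>z. f (reflect m B z)) x = path_casimir \<alpha> \<beta> k f (reflect m B x)"
  using assms by (simp add: path_casimir_def path_op_reflect)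

text \<open>Above level i the link coefficients involve only coordinates beyond i, which the Casimir
  of level i leaves fixed; commutation therefore passes from level k to k + 1.\<close>

lemma path_casimir_path_op_commute:
  assumes "i \<le> k" "regular_point \<alpha> i x" "A \<in> {-1, 0, 1}"
  shows "path_casimir \<alpha> \<beta> i (path_op \<alpha> \<beta> k A f) x = path_op \<alpha> \<beta> k A (path_casimir \<alpha> \<beta> i f) x"
  using assms
proof (induction k arbitrary: A x rule: dec_induct)
  case base
  show ?case
  proof (cases "A = 0")
    case True
    then show ?thesis
      using path_op_path_casimir[of 0 \<alpha> \<beta> i f x]
          by (simp add: refl_coord_def path_casimir_def[of \<alpha> \<beta> i "path_op \<alpha> \<beta> i 0 f"])
  next
    case False
    then show ?thesis using path_op_relations[of \<alpha> i x A \<beta> f] base by auto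
  qed
next
  case (step k)
  have summand: "path_casimir \<alpha> \<beta> i (\<lambda>z. link_coeff (\<alpha> (k + 2)) C A (ycoord \<alpha> (k
      + 1) z) (ycoord \<alpha> (k + 2) z) * path_op \<alpha> \<beta> k C f (reflect (k + 2) A z)) x
      = link_coeff (\<alpha> (k + 2)) C A (ycoord \<alpha> (k + 1) x) (ycoord \<alpha> (k
          + 2) x) * path_op \<alpha> \<beta> k C (path_casimir \<alpha> \<beta> i f) (reflect (k + 2) A x)"
    if "C \<in> {-1, 0, 1}" for C
  proof -
    have "regular_point \<alpha> i (reflect (k + 2) A x)"
      using step.prems step.hyps by (auto simp: regular_point_def)
    then show ?thesis
      using step.IH[OF _ that, of "reflect (k + 2) A x"] step.hyps
      by (subst path_casimir_mult) (auto simp: path_casimir_reflect)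
  qed
  have "path_op \<alpha> \<beta> (Suc k) A f = (\<lambda>z.
      link_coeff (\<alpha> (k + 2)) (-1) A (ycoord \<alpha> (k + 1) z) (ycoord \<alpha> (k
          + 2) z) * path_op \<alpha> \<beta> k (-1) f (reflect (k + 2) A z)
      + (link_coeff (\<alpha> (k + 2)) 0 A (ycoord \<alpha> (k + 1) z) (ycoord \<alpha> (k
          + 2) z) * path_op \<alpha> \<beta> k 0 f (reflect (k + 2) A z)
      + link_coeff (\<alpha> (k + 2)) 1 A (ycoord \<alpha> (k + 1) z) (ycoord \<alpha> (k
          + 2) z) * path_op \<alpha> \<beta> k 1 f (reflect (k + 2) A z)))"
    by (rule ext) simp
  then show ?case by (simp only: path_casimir_add summand insert_iff simp_thms) simp
qed

section \<open>The sum over shifts as a path operator\<close>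

lemma shifts_0: "shifts 0 = {\<lambda>_. 0}"
  by (auto simp: shifts_def)

lemma shifts_Suc: "shifts (Suc j) = (\<lambda>(c, \<nu>). \<nu>(Suc j := c)) ` ({-1, 0, 1} \<times> shifts j)"
proof (intro equalityI subsetI)
  fix \<mu> assume \<mu>: "\<mu> \<in> shifts (Suc j)"
  then have "\<mu> (Suc j) \<in> {-1, 0, 1}" unfolding shifts_def by simp
  moreover from \<mu> have "\<mu>(Suc j := 0) \<in> shifts j" by (simp add: shifts_def le_Suc_eq)
  ultimately have "(\<mu> (Suc j), \<mu>(Suc j := 0)) \<in> {-1, 0, 1} \<times> shifts j" by simp
  then show "\<mu> \<in> (\<lambda>(c, \<nu>). \<nu>(Suc j := c)) ` ({-1, 0, 1} \<times> shifts j)"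
    by (rule rev_image_eqI) simp
next
  fix \<mu> assume "\<mu> \<in> (\<lambda>(c, \<nu>). \<nu>(Suc j := c)) ` ({-1, 0, 1} \<times> shifts j)"
  then show "\<mu> \<in> shifts (Suc j)"
    by (elim imageE) (auto simp: shifts_def le_Suc_eq)
qed

lemma sum_shifts_Suc:
  "(\<Sum>\<nu>\<in>shifts (Suc j). F \<nu>) = (\<Sum>c\<in>{-1, 0, 1}. \<Sum>\<nu>\<in>shifts j. F (\<nu>(Suc j := c)))"
proof -
  have "\<nu> = \<nu>'" if "\<nu> \<in> shifts j" "\<nu>' \<in> shifts j" "\<nu>(Suc j := c) = \<nu>'(Suc j := c')" for \<nu> \<nu>' c c'
  proof
    fix i show "\<nu> i = \<nu>' i"
      using that(1,2) fun_cong[OF that(3), of i] by (cases "i = Suc j") (auto simp: shifts_def)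
  qed
  then have "inj_on (\<lambda>(c, \<nu>). \<nu>(Suc j := c)) ({-1, 0, 1} \<times> shifts j)"
    by (auto simp: inj_on_def dest: fun_cong[of _ _ "Suc j"])
  then show ?thesis
    unfolding shifts_Suc by (simp add: sum.reindex sum.cartesian_product case_prod_unfold)
qed

lemma C_coeff_Suc:
  "C_coeff \<alpha> \<beta> (Suc j) \<nu> x = C_coeff \<alpha> \<beta> j \<nu> x
    * (B_coeff \<alpha> \<beta> (Suc j) (\<nu> (Suc j)) (\<nu> (Suc (Suc j))) x / b_coeff \<alpha> (Suc j) (\<nu> (Suc j)) x)"
  by (simp add: C_coeff_def)

lemma C_coeff_cong:
  assumes \<nu>: "\<And>i. i \<le> Suc j \<Longrightarrow> \<nu> i = \<nu>' i" and x: "\<And>i. i \<le> Suc j \<Longrightarrow> x i = x' i"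
  shows "C_coeff \<alpha> \<beta> j \<nu> x = C_coeff \<alpha> \<beta> j \<nu>' x'"
proof -
  have "B_coeff \<alpha> \<beta> l a b x = B_coeff \<alpha> \<beta> l a b x'" if "l \<le> j" for l a b
  proof -
    have "x 1 = x' 1" "x l = x' l" "x (l + 1) = x' (l + 1)" using x that by simp_all
    then show ?thesis unfolding B_coeff_def B_zero_def B_pos_def by (simp only:)
  qed
  moreover have "b_coeff \<alpha> l a x = b_coeff \<alpha> l a x'" if "l \<le> j" for l a
    using x[of l] that by (simp add: b_coeff_def)
  ultimately show ?thesis
    unfolding C_coeff_def by (intro arg_cong2[where f = "(/)"] prod.cong) (simp_all add: \<nu>)
qed

definition parity_sign :: "int \<Rightarrow> int" where "parity_sign m = (if even m then 1 else -1)"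

text \<open>Label A stands for the shift by A times the parity sign; under this relabelling
  numerators and denominators agree separately.\<close>

lemma link_coeff_eq_coeff:
  assumes "A \<in> {-1, 0, 1}" "B \<in> {-1, 0, 1}"
  shows "B_coeff \<alpha> \<beta> (Suc j) (A * parity_sign (x (Suc j))) (B * parity_sign (x (Suc (Suc j)))) x
      / b_coeff \<alpha> (Suc j) (A * parity_sign (x (Suc j))) x
    = link_coeff (\<alpha> (j + 2)) A B (ycoord \<alpha> (j + 1) x) (ycoord \<alpha> (j + 2) x)"
proof -
  define p q where "p = real_of_int (x (Suc j))" and "q = real_of_int (x (Suc (Suc j)))"
  define S a where "S = asum \<alpha> 1 (Suc j)" and "a = \<alpha> (Suc (Suc j))"
  have S: "asum \<alpha> 1 (Suc (Suc j)) = S + a" by (simp add: asum_def S_def a_def)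
  note folds = p_def[symmetric] q_def[symmetric] a_def[symmetric] S_def[unfolded One_nat_def,
      symmetric]
    S[unfolded One_nat_def]
  have "B_pos \<alpha> (Suc j) (A * parity_sign (x (Suc j))) (B * parity_sign (x (Suc (Suc j)))) x
     = (if A = 0 \<and> B = 0 then 1 - a - ycoord \<alpha> (j + 1) x * ycoord \<alpha> (j + 2) x
     else if A = 0 then of_int B * (ycoord \<alpha> (j + 1) x - ycoord \<alpha> (j + 2) x - of_int B * a)
     else if B = 0 then of_int A * (ycoord \<alpha> (j + 2) x - ycoord \<alpha> (j + 1) x - of_int A * a)
     else - of_int A * (ycoord \<alpha> (j + 1) x + of_int (A * B) * ycoord \<alpha> (j + 2) x + of_int A * a
         + of_int (A + B)))"
    using assms
    by (cases "even (x (Suc j))"; cases "even (x (Suc (Suc j)))";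
        auto simp: B_pos_def Let_def ycoord_def parity_sign_def minus_one_powi folds; simp add:
            algebra_simps)
  moreover have "b_coeff \<alpha> (Suc j) (A * parity_sign (x (Suc j))) x =
    (if A = 0 then - (ycoord \<alpha> (j + 1) x + 1) * (ycoord \<alpha> (j + 1) x - 1) else
        - 2 * (of_int A * ycoord \<alpha> (j + 1) x + 1))"
    using assms(1)
    by (cases "even (x (Suc j))") (auto simp: b_coeff_def ycoord_def parity_sign_def
        minus_one_powi folds algebra_simps)
  ultimately show ?thesis by (simp add: B_coeff_def link_coeff_def a_def)
qed

text \<open>The entry of index j + 1 is prescribed instead of zero, which is what makes peeling off
  one coordinate at a time work.\<close>

lemma sum_shifts_eq_path_op:
  assumes "A \<in> {-1, 0, 1}"
  shows "(\<Sum>\<nu>\<in>shifts j. C_coeff \<alpha> \<beta> j (\<nu>(Suc j := A * parity_sign (x (Suc j)))) x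
      * f (shift (\<nu>(Suc j := A * parity_sign (x (Suc j)))) x)) = path_op \<alpha> \<beta> j A f x"
  using assms
proof (induction j arbitrary: A x)
  case 0
  have "shift ((\<lambda>_. 0)(Suc 0 := A * parity_sign (x (Suc 0)))) x = reflect 1 A x"
    by (auto simp: shift_def reflect_def parity_sign_def)
  moreover have "C_coeff \<alpha> \<beta> 0 ((\<lambda>_. 0)(Suc 0 := A * parity_sign (x (Suc 0)))) x
      = edge_coeff \<beta> (\<beta> - \<alpha> 1 + 1) A (ycoord \<alpha> 1 x)"
    using 0 by (auto simp: C_coeff_def B_coeff_def B_zero_def edge_coeff_def ycoord_def asum_def
        parity_sign_def
        minus_one_powi field_simps)
  moreover have "sum F {\<lambda>_. 0} = F (\<lambda>_. 0)" for F :: "(nat \<Rightarrow> int) \<Rightarrow> real" by simp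
  ultimately show ?case by (simp only: shifts_0 path_op.simps)
next
  case (Suc j)
  define s where "s = parity_sign (x (Suc j))"
  define x' where "x' = reflect (j + 2) A x"
  let ?t = "A * parity_sign (x (Suc (Suc j)))"
  have s: "s = 1 \<or> s = -1" by (simp add: s_def parity_sign_def)
  have sh: "shift (\<nu>(Suc j := c, Suc (Suc j) := ?t)) x = shift (\<nu>(Suc j := c)) x'"
    if "\<nu> \<in> shifts j" for \<nu> c
    using that by (auto simp: shift_def x'_def reflect_def parity_sign_def shifts_def fun_eq_iff)
  have "(\<Sum>\<nu>\<in>shifts (Suc j). C_coeff \<alpha> \<beta> (Suc j) (\<nu>(Suc (Suc j) := ?t)) x
      * f (shift (\<nu>(Suc (Suc j) := ?t)) x))
    = (\<Sum>c\<in>{-1, 0, 1}. B_coeff \<alpha> \<beta> (Suc j) c ?t x / b_coeff \<alpha> (Suc j) c x *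
        (\<Sum>\<nu>\<in>shifts j. C_coeff \<alpha> \<beta> j (\<nu>(Suc j := c)) x' * f (shift (\<nu>(Suc j := c)) x')))"
    unfolding sum_shifts_Suc sum_distrib_left
  proof (intro sum.cong HOL.refl)
    fix c \<nu> assume "\<nu> \<in> shifts j"
    have "C_coeff \<alpha> \<beta> j (\<nu>(Suc j := c, Suc (Suc j) := ?t)) x = C_coeff \<alpha> \<beta> j (\<nu>(Suc j := c)) x'"
      by (rule C_coeff_cong) (auto simp: x'_def reflect_def)
    then show "C_coeff \<alpha> \<beta> (Suc j) (\<nu>(Suc j := c, Suc (Suc j) := ?t)) x
        * f (shift (\<nu>(Suc j := c, Suc (Suc j) := ?t)) x)
      = B_coeff \<alpha> \<beta> (Suc j) c ?t x / b_coeff \<alpha> (Suc j) c x *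
          (C_coeff \<alpha> \<beta> j (\<nu>(Suc j := c)) x' * f (shift (\<nu>(Suc j := c)) x'))"
      using sh[OF \<open>\<nu> \<in> shifts j\<close>] by (simp add: C_coeff_Suc)
  qed
  also have "\<dots> = (\<Sum>C\<in>{-1, 0, 1}. B_coeff \<alpha> \<beta> (Suc j) (C * s) ?t x / b_coeff \<alpha> (Suc j) (C * s) x *
        (\<Sum>\<nu>\<in>shifts j. C_coeff \<alpha> \<beta> j (\<nu>(Suc j := C * s)) x' * f (shift (\<nu>(Suc j := C * s)) x')))"
    using s by (elim disjE) simp_all
  also have "\<dots> = path_op \<alpha> \<beta> (Suc j) A f x"
  proof -
    have s': "s = parity_sign (x' (Suc j))" by (simp add: s_def x'_def reflect_def)
    show ?thesis
      unfolding path_op.simps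
    proof (rule sum.cong[OF HOL.refl])
      fix C :: int assume C: "C \<in> {-1, 0, 1}"
      show "B_coeff \<alpha> \<beta> (Suc j) (C * s) ?t x / b_coeff \<alpha> (Suc j) (C * s) x *
          (\<Sum>\<nu>\<in>shifts j. C_coeff \<alpha> \<beta> j (\<nu>(Suc j := C * s)) x' * f (shift (\<nu>(Suc j := C * s)) x'))
        = link_coeff (\<alpha> (j + 2)) C A (ycoord \<alpha> (j + 1) x) (ycoord \<alpha> (j
            + 2) x) * path_op \<alpha> \<beta> j C f (reflect (j + 2) A x)"
        unfolding Suc.IH[OF C, of x', folded s'] link_coeff_eq_coeff[OF C Suc.prems, of \<alpha> \<beta> j x,
            folded s_def] unfolding x'_def ..
    qed
  qed
  finally show ?case .
qed

text \<open>The additive term of \<open>L_op\<close> with the alternating sign is exactly the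
  correction by Y of index j + 1 in the Casimir.\<close>

lemma L_op_eq_path_casimir: "L_op \<alpha> \<beta> j f = (\<lambda>x. path_casimir \<alpha> \<beta> j f x + (asum \<alpha> 2 (j + 1)
    + \<beta>) / 2 * f x)"
proof
  fix x
  have "\<nu>(Suc j := 0) = \<nu>" if "\<nu> \<in> shifts j" for \<nu>
    using that by (auto simp: shifts_def)
  then have "(\<Sum>\<nu>\<in>shifts j. C_coeff \<alpha> \<beta> j \<nu> x * f (shift \<nu> x)) = path_op \<alpha> \<beta> j 0 f x"
    using sum_shifts_eq_path_op[where A = 0 and j = j and x = x and f = f and \<alpha> = \<alpha> and \<beta> = \<beta>]
        by simp
  then show "L_op \<alpha> \<beta> j f x = path_casimir \<alpha> \<beta> j f x + (asum \<alpha> 2 (j + 1) + \<beta>) / 2 * f x"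
    by (simp add: L_op_def path_casimir_def ycoord_def field_simps)
qed

text \<open>Needed because \<open>mvBI_hat\<close> resets entry s + 1 to N: an operator that does
  not move this entry cannot see the reset.\<close>

lemma path_op_upd:
  assumes "k + 1 < m \<or> k + 1 = m \<and> A = 0" "x m = v"
  shows "path_op \<alpha> \<beta> k A (\<lambda>z. f (z(m := v))) x = path_op \<alpha> \<beta> k A f x"
  using assms
proof (induction k arbitrary: A x)
  case 0
  then have "(reflect 1 A x)(m := v) = reflect 1 A x" by (auto simp: reflect_def)
  then show ?case by (simp only: path_op.simps)
next
  case (Suc k)
  have "path_op \<alpha> \<beta> k C (\<lambda>z. f (z(m := v))) (reflect (k + 2) A x) = path_op \<alpha> \<beta> k C f (reflect (k
      + 2) A x)" for C
    by (rule Suc.IH) (use Suc.prems in \<open>auto simp: reflect_def\<close>)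
  then show ?case by (simp only: path_op.simps)
qed

section \<open>The multivariate polynomials as eigenfunctions\<close>

definition deg_sign :: "(nat \<Rightarrow> nat) \<Rightarrow> nat \<Rightarrow> int" where
  "deg_sign n k = (-1) ^ psum n k"

lemma deg_sign_cases: "deg_sign n k = 1 \<or> deg_sign n k = -1"
  by (cases "even (psum n k)") (auto simp: deg_sign_def)

lemma mvBI_factor_eq:
  fixes \<alpha> \<beta> n k
  defines "b \<equiv> 2 * real (psum n (k - 1)) + asum \<alpha> 2 k + \<beta>"
    and "t \<equiv> of_int (deg_sign n (k - 1))"
  assumes "k \<ge> 1"
  shows "mvBI_factor n y \<alpha> \<beta> k =
    bi_poly b (\<beta> - \<alpha> 1 + 1) (b + \<alpha> (k + 1) - 1) (n k) (t * ycoord \<alpha> k y) (t * ycoord \<alpha> (k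
        + 1) y) / 4 ^ n k"
proof -
  let ?M = "psum n (k - 1)"
  have sgn: "(-1) powi (int ?M + m) = t * (-1) powi m" for m
    by (auto simp: t_def deg_sign_def minus_one_powi)
  have asum1: "asum \<alpha> 1 k = \<alpha> 1 + asum \<alpha> 2 k"
    using assms(3) by (simp add: asum_def sum.atLeast_Suc_atMost numeral_2_eq_2)
  have cong: "BI m x p q r s = BI m x' p' q' r' s'"
    if "x = x'" "p = p'" "q = q'" "r = r'" "s = s'" for m x x' p p' q q' r r' s s'
    using that by simp
  show ?thesis
    unfolding mvBI_factor_def Let_def sgn BI_eq_bi_poly[symmetric]
    by (rule cong) (simp_all add: b_def asum1[unfolded One_nat_def] ycoord_def field_simps)
qed

lemma mvBI_factor_reflect:
  assumes "l < k"
  shows "mvBI_factor n (reflect l C y) \<alpha> \<beta> k = mvBI_factor n y \<alpha> \<beta> k"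
  using assms by (simp add: mvBI_factor_def reflect_def)

lemma mvBI_factor_reflect':
  assumes "l > k + 1"
  shows "mvBI_factor n (reflect l C y) \<alpha> \<beta> k = mvBI_factor n y \<alpha> \<beta> k"
  using assms by (simp add: mvBI_factor_def reflect_def)

lemma sum_sign_reindex:
  fixes t :: int
  assumes "t = 1 \<or> t = -1"
  shows "(\<Sum>A\<in>{-1, 0, 1 :: int}. F (t * A)) = (\<Sum>A\<in>{-1, 0, 1}. F A :: real)"
  using assms by (elim disjE) (simp_all add: add_ac)

lemma link_coeff_sign:
  fixes t :: int
  assumes "t = 1 \<or> t = -1"
  shows "link_coeff a (t * A) (t * B) (of_int t * Y) (of_int t * Z) = link_coeff a A B Y Z"
    and "refl_coord (t * A) (of_int t * Y) = of_int t * refl_coord A Y"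
  using assms by (auto simp: link_coeff_neg refl_coord_neg)

text \<open>The new factor is unaffected by reflections of the first j coordinates, so it can be
  pulled out of the level j operator. The remaining sum over the label C is a \<open>bi_op\<close>
  in one variable.\<close>

lemma path_op_eigen:
  fixes n :: "nat \<Rightarrow> nat" and \<alpha> \<beta> j
  defines "P \<equiv> \<lambda>j y. \<Prod>k=1..j. mvBI_factor n y \<alpha> \<beta> k"
    and "t \<equiv> deg_sign n"
  assumes "\<beta> > 0" "\<And>i. i \<in> {2..j + 1} \<Longrightarrow> \<alpha> i > 1"
    and "\<And>l. l \<in> {1..j} \<Longrightarrow> ycoord \<alpha> l x \<notin> {1, -1}"
    and "A \<in> {-1, 0, 1}"
  shows "path_op \<alpha> \<beta> j A (P j) x =
    of_int (t j) * edge_coeff (2 * real (psum n j) + asum \<alpha> 2 (j + 1) + \<beta>) (\<beta> - \<alpha> 1 + 1)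
      (t j * A) (of_int (t j) * ycoord \<alpha> (j + 1) x) * P j x"
  using assms(3-)
proof (induction j arbitrary: A x)
  case 0
  then show ?case by (simp add: P_def t_def deg_sign_def psum_def asum_def)
next
  case (Suc j)
  note B = Suc.prems(4)
  define a where "a = \<alpha> (j + 2)"
  define b where "b = 2 * real (psum n j) + asum \<alpha> 2 (j + 1) + \<beta>"
  define g where "g = \<beta> - \<alpha> 1 + 1"
  define h where "h = b + a - 1"
  define s where "s = t j"
  define s' where "s' = real_of_int s"
  define m where "m = n (Suc j)"
  define Y where "Y = ycoord \<alpha> (j + 1) x"
  define Z where "Z = ycoord \<alpha> (j + 2) x"
  define x' where "x' = reflect (j + 2) A x"
  let ?F = "\<lambda>y. mvBI_factor n y \<alpha> \<beta> (Suc j)"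
  have s: "s = 1 \<or> s = -1" unfolding s_def t_def by (rule deg_sign_cases)
  have F: "?F y = bi_poly b g h m (s' * ycoord \<alpha> (j + 1) y) (s' * ycoord \<alpha> (j + 2) y) / 4 ^ m" for y
    using mvBI_factor_eq[of "Suc j" n y \<alpha> \<beta>]
    by (simp add: b_def g_def h_def a_def s'_def s_def t_def m_def)
  \<comment> \<open>Positivity of \<open>h\<close>, from the bounds on the parameters, keeps all
    recurrence denominators nonzero.\<close>
  have "asum \<alpha> 2 (j + 1) \<ge> 0"
    unfolding asum_def using Suc.prems(2)
        by (intro sum_nonneg) (force intro: less_imp_le order_trans[of 0 1])
  moreover have "a > 1" unfolding a_def by (rule Suc.prems(2)) simp
  ultimately have h: "h > 0" using Suc.prems(1) by (simp add: h_def b_def)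
  have Y: "s' * Y \<noteq> 1" "s' * Y \<noteq> -1"
    using Suc.prems(3)[of "j + 1"] s by (auto simp: s'_def Y_def)
  have x': "ycoord \<alpha> (j + 1) x' = Y" "ycoord \<alpha> (j + 2) x' = refl_coord A Z" "P j x' = P j x"
    unfolding x'_def Y_def Z_def P_def
    by (simp, simp only: ycoord_reflect[OF B], intro prod.cong HOL.refl mvBI_factor_reflect') auto
  have P: "P (Suc j) = (\<lambda>y. ?F y * P j y)" by (simp add: P_def mult.commute)
  have term1: "path_op \<alpha> \<beta> j C (P (Suc j)) x' =
      bi_poly b g h m (refl_coord (s * C) (s' * Y)) (refl_coord (s * A) (s' * Z)) / 4 ^ m
        * (s' * edge_coeff b g (s * C) (s' * Y) * P j x)" if C: "C \<in> {-1, 0, 1}" for C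
  proof -
    have "path_op \<alpha> \<beta> j C (P (Suc j)) x' = ?F (reflect (j + 1) C x') * path_op \<alpha> \<beta> j C (P j) x'"
      unfolding P by (rule path_op_mult) (simp add: mvBI_factor_reflect)
    also have "path_op \<alpha> \<beta> j C (P j) x' = s' * edge_coeff b g (s * C) (s' * Y) * P j x"
    proof -
      have "ycoord \<alpha> l x' \<notin> {1, -1}" if "l \<in> {1..j}" for l
        using Suc.prems(3)[of l] that by (simp add: x'_def)
      from Suc.IH[OF Suc.prems(1) _ this C] Suc.prems(2) show ?thesis
        unfolding x' by (simp add: s_def s'_def b_def g_def)
    qed
    also have "?F (reflect (j + 1) C x')
        = bi_poly b g h m (refl_coord (s * C) (s' * Y)) (refl_coord (s * A) (s' * Z)) / 4 ^ m"
      unfolding F using link_coeff_sign(2)[OF s]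
          by (simp add: ycoord_reflect[OF C] x'[simplified] s'_def)
    finally show ?thesis .
  qed
  have "path_op \<alpha> \<beta> (Suc j) A (P (Suc j)) x =
      (\<Sum>C\<in>{-1, 0, 1}. link_coeff a C A Y Z * path_op \<alpha> \<beta> j C (P (Suc j)) x')"
    by (simp only: path_op.simps a_def Y_def Z_def x'_def)
  also have "\<dots> = (\<Sum>C\<in>{-1, 0, 1}. s' * P j x / 4 ^ m * (edge_coeff b g (s * C) (s' * Y)
      * link_coeff a (s * C) (s * A) (s' * Y) (s' * Z) * bi_poly b g h m (refl_coord (s * C) (s' *
          Y)) (refl_coord (s * A) (s' * Z))))"
    by (intro sum.cong HOL.refl) (simp add: term1 link_coeff_sign(1)[OF s] s'_def)
  also have "\<dots>
      = s' * P j x / 4 ^ m * bi_op b g a (s * A) (s' * Z) (\<lambda>y. bi_poly b g h m y (refl_coord (s *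
      A) (s' * Z))) (s' * Y)"
    unfolding bi_op_def sum_distrib_left[symmetric]
    by (subst sum_sign_reindex[OF s, of
        "\<lambda>C. edge_coeff b g C (s' * Y) * link_coeff a C (s * A) (s' * Y) (s' * Z) * bi_poly b g h
        m (refl_coord C (s' * Y)) (refl_coord (s * A) (s' * Z))"]) simp
  also have "\<dots> = s' * P j x / 4 ^ m * ((-1) ^ m * edge_coeff (2 * real m + h
      + 1) g ((-1) ^ m * (s * A)) ((-1) ^ m * (s' * Z)) * bi_poly b g h m (s' * Y) (s' * Z))"
  proof -
    have "s * A \<in> {-1, 0, 1}" using s B by auto
    from bi_op_eigen[OF Y h this, of b g "s' * Z" m] show ?thesis by (simp add: h_def)
  qed
  also have "\<dots> = of_int (t (Suc j)) * edge_coeff (2 * real (psum n (Suc j)) + asum \<alpha> 2 (Suc j + 1)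
      + \<beta>) g
      (t (Suc j) * A) (of_int (t (Suc j)) * Z) * P (Suc j) x"
  proof -
    have "t (Suc j) = (-1) ^ m * s"
      by (simp add: t_def deg_sign_def s_def m_def psum_def power_add)
    moreover have "2 * real (psum n (Suc j)) + asum \<alpha> 2 (Suc j + 1) + \<beta> = 2 * real m + h + 1"
      by (simp add: psum_def asum_def h_def b_def a_def m_def)
    moreover have "P (Suc j) x = bi_poly b g h m (s' * Y) (s' * Z) / 4 ^ m * P j x"
      unfolding P F by (simp add: Y_def Z_def)
    ultimately show ?thesis by (simp add: s'_def mult_ac)
  qed
  finally show ?case unfolding g_def Z_def by simp
qed

lemma coeffs_defined_ycoord:
  assumes "coeffs_defined \<alpha> j x" "l \<in> {1..j}"
  shows "ycoord \<alpha> l x \<notin> {1, -1}"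
proof -
  have "b_coeff \<alpha> l 0 x \<noteq> 0" using assms by (auto simp: coeffs_defined_def)
  then show ?thesis
    by (cases "even (x l)") (auto simp: b_coeff_def ycoord_def minus_one_powi)
qed

text \<open>Definedness at x and at its two reflections in coordinate l excludes 1 and -1 for Y, -Y
  - 2 and -Y + 2.\<close>

lemma product_defined_regular_point:
  assumes "product_defined \<alpha> i j x" "i \<le> j"
  shows "regular_point \<alpha> i x"
  unfolding regular_point_def
proof
  fix l assume l: "l \<in> {1..i}"
  have "ycoord \<alpha> l (reflect l A x) \<notin> {1, -1}" if "A \<in> {-1, 0, 1}" for A
  proof (rule coeffs_defined_ycoord)
    let ?\<nu> = "(\<lambda>_. 0)(l := A * parity_sign (x l))"
    have "?\<nu> \<in> shifts i" using l that by (auto simp: shifts_def parity_sign_def)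
    moreover have "shift ?\<nu> x = reflect l A x" by (auto simp: shift_def reflect_def parity_sign_def)
    ultimately show "coeffs_defined \<alpha> j (reflect l A x)"
      using assms(1) unfolding product_defined_def by metis
    show "l \<in> {1..j}" using l assms(2) by auto
  qed
  from this[of 0] this[of 1] this[of "-1"] show "ycoord \<alpha> l x \<notin> {1, -1, 3, -3}"
    unfolding ycoord_reflect[of 1, simplified] ycoord_reflect[of "-1", simplified]
    by (auto simp: refl_coord_def)
qed

text \<open>The smaller Casimir commutes with the label 0 operator of level j and with
  multiplication by the coordinate of index j + 1, which it does not move.\<close>

lemma L_op_commute:
  assumes "i \<le> j" "regular_point \<alpha> i x"
  shows "L_op \<alpha> \<beta> i (L_op \<alpha> \<beta> j f) x = L_op \<alpha> \<beta> j (L_op \<alpha> \<beta> i f) x"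
proof -
  have "path_casimir \<alpha> \<beta> i (path_casimir \<alpha> \<beta> j f) x = path_casimir \<alpha> \<beta> j (path_casimir \<alpha> \<beta> i f) x"
  proof -
    let ?c = "- (\<beta> - \<alpha> 1 + 1) / 2"
    have "path_casimir \<alpha> \<beta> i (\<lambda>z. ?c * ycoord \<alpha> (j + 1) z * f z) x = ?c * ycoord \<alpha> (j
        + 1) x * path_casimir \<alpha> \<beta> i f x"
      using assms(1) by (intro path_casimir_mult) simp
    then show ?thesis
      unfolding path_casimir_alt[of \<alpha> \<beta> j] path_casimir_add
      using path_casimir_path_op_commute[OF assms, of 0 \<beta> f] by simp
  qed
  then show ?thesis
    unfolding L_op_eq_path_casimir path_casimir_add path_casimir_cmult by (simp add: field_simps)
qed

text \<open>Factors beyond j are constant under the shifts of the first j coordinates and come out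
  together with the normalizing constant.\<close>

lemma L_op_mvBI_hat:
  assumes "\<beta> > 0" and \<alpha>: "\<And>i. i \<in> {2..s + 1} \<Longrightarrow> \<alpha> i > 1"
    and j: "j \<in> {1..s}" and N: "x (s + 1) = int N" and "coeffs_defined \<alpha> j x"
  shows "L_op \<alpha> \<beta> j (\<lambda>y. mvBI_hat s n y \<alpha> \<beta> N) x = mu \<alpha> \<beta> n j * mvBI_hat s n x \<alpha> \<beta> N"
proof -
  define P where "P = (\<lambda>y. \<Prod>k=1..j. mvBI_factor n y \<alpha> \<beta> k)"
  define R where "R = (\<lambda>y. norm_const s n \<alpha> \<beta> N * (\<Prod>k=j + 1..s. mvBI_factor n y \<alpha> \<beta> k))"
  define F where "F = (\<lambda>y. mvBI_hat s n y \<alpha> \<beta> N)"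
  let ?c = "(\<beta> - \<alpha> 1 + 1) / 2 * ycoord \<alpha> (j + 1) x"
  have split: "(\<Prod>k=1..s. G k) = (\<Prod>k=j + 1..s. G k) * (\<Prod>k=1..j. G k)" for G :: "nat \<Rightarrow> real"
    using j prod.ub_add_nat[of 1 j G "s - j"] by (simp add: mult.commute)
  have F: "F = (\<lambda>y. R (y(s + 1 := int N)) * P (y(s + 1 := int N)))"
    unfolding F_def mvBI_hat_def mvBI_def R_def P_def split mult.assoc ..
  have Fx: "F x = R x * P x"
    using N by (simp add: F fun_upd_idem)
  have "path_op \<alpha> \<beta> j 0 F x = path_op \<alpha> \<beta> j 0 (\<lambda>y. R y * P y) x"
    unfolding F using j N by (intro path_op_upd) auto
  also have "\<dots> = R x * path_op \<alpha> \<beta> j 0 P x"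
  proof -
    have "R (reflect l C z) = R z" if "l \<in> {1..j}" for l C z
      unfolding R_def using that by (intro arg_cong2[where f =
          "(*)"] prod.cong HOL.refl mvBI_factor_reflect) auto
    from path_op_mult[of j R, OF this] show ?thesis by simp
  qed
  \<comment> \<open>In the term with Y the degree sign occurs twice and cancels; in the constant
    term it survives and yields \<open>mu\<close>.\<close>
  also have "path_op \<alpha> \<beta> j 0 P x = (?c + mu \<alpha> \<beta> n j - (asum \<alpha> 2 (j + 1) + \<beta>) / 2) * P x"
  proof -
    have "path_op \<alpha> \<beta> j 0 P x = of_int (deg_sign n j) * edge_coeff (2 * real (psum n j)
        + asum \<alpha> 2 (j + 1) + \<beta>) (\<beta> - \<alpha> 1 + 1)
      (deg_sign n j * 0) (of_int (deg_sign n j) * ycoord \<alpha> (j + 1) x) * P x"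
      unfolding P_def
      by (rule path_op_eigen) (use assms coeffs_defined_ycoord in auto)
    then show ?thesis
      by (cases "even (psum n j)") (simp_all add: edge_coeff_def deg_sign_def mu_def field_simps)
  qed
  finally have "path_op \<alpha> \<beta> j 0 F x = R x * ((?c + mu \<alpha> \<beta> n j - (asum \<alpha> 2 (j + 1)
      + \<beta>) / 2) * P x)" .
  then have "L_op \<alpha> \<beta> j F x = mu \<alpha> \<beta> n j * F x"
    unfolding L_op_eq_path_casimir path_casimir_def Fx by (simp add: field_simps)
  then show ?thesis unfolding F_def .
qed

theorem proposition10:
  fixes s N :: nat and \<alpha> :: "nat \<Rightarrow> real" and \<beta> :: real
  assumes "s \<ge> 1"
    and "\<alpha> 1 - 1 > \<beta>" and "\<beta> > 0"
    and "\<And>i. i \<in> {2..s+1} \<Longrightarrow> \<alpha> i > 1"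
  shows "(\<forall>i\<in>{1..s}. \<forall>j\<in>{1..s}. \<forall>(f :: point \<Rightarrow> real) (x :: point).
            x (s+1) = int N \<longrightarrow> product_defined \<alpha> i j x \<longrightarrow> product_defined \<alpha> j i x \<longrightarrow>
            L_op \<alpha> \<beta> i (L_op \<alpha> \<beta> j f) x = L_op \<alpha> \<beta> j (L_op \<alpha> \<beta> i f) x) \<and>
         (\<forall>n :: nat \<Rightarrow> nat. \<forall>j\<in>{1..s}. \<forall>x :: point.
            x (s+1) = int N \<longrightarrow> coeffs_defined \<alpha> j x \<longrightarrow>
            L_op \<alpha> \<beta> j (\<lambda>y. mvBI_hat s n y \<alpha> \<beta> N) x = mu \<alpha> \<beta> n j * mvBI_hat s n x \<alpha> \<beta> N)"
proof (intro conjI ballI allI impI)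
  fix i j and f :: "point \<Rightarrow> real" and x :: point
  assume "product_defined \<alpha> i j x" "product_defined \<alpha> j i x"
  then show "L_op \<alpha> \<beta> i (L_op \<alpha> \<beta> j f) x = L_op \<alpha> \<beta> j (L_op \<alpha> \<beta> i f) x"
    by (metis L_op_commute product_defined_regular_point nle_le)
next
  fix n :: "nat \<Rightarrow> nat" and j and x :: point
  assume "j \<in> {1..s}" "x (s + 1) = int N" "coeffs_defined \<alpha> j x"
  with assms(3,4) show "L_op \<alpha> \<beta> j (\<lambda>y. mvBI_hat s n y \<alpha> \<beta> N) x = mu \<alpha> \<beta> n j * mvBI_hat s n x \<alpha> \<beta> N"
    by (rule L_op_mvBI_hat)
qed

end
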